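(* Let $E$ be a sandpile graph and $S_E$ the set of all vertices in $E$ which do not connect to any cycle in $E$. Then the following statements hold: (1) For all $x\in\mathrm{SP}(E)$, the archimedean class $[x]$ is a subsemigroup of $\mathrm{SP}(E)$ containing a unique idempotent; (2) $\mathrm{SP}(E)=\bigsqcup_{x\in\mathrm{Idem}(\mathrm{SP}(E))}[x]$; (3) $G(E)=\varinjlim_{x\in\mathrm{Idem}(\mathrm{SP}(E))}G([x])$, where $G([x])$ is the Grothendieck group of $[x]$; (4) For all $x\in\mathrm{Idem}(\mathrm{SP}(E))$, $$G([x])\cong x+[x]=\begin{cases}G(E_{S_E}) & \text{if } x=0,\\ G(E_H) & \text{if } x\neq 0,\end{cases}$$ where $H=\overline{\mathrm{supp}(x)}$. In particular, $G(E)\cong e_{\max}+[e_{\max}]$, where $e_{\max}=\sum_{x\in\mathrm{Idem}(\mathrm{SP}(E))}x$; (5) For every maximal subgroup $G$ of $\mathrm{SP}(E)$, $G\cong x+[x]$ for some $x\in\mathrm{Idem}(\mathrm{SP}(E))$. Consequently, the set of all maximal subgroups of $\mathrm{SP}(E)$ is exactly the set $\{x+[x]\mid x\in\mathrm{Idem}(\mathrm{SP}(E))\}$.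
   Context: Graphs are directed: $E=(E^0,E^1,s,r)$ with source and range maps $s,r:E^1\to E^0$. A sink is a vertex emitting no edges; a vertex is regular if it is not a sink and emits only finitely many edges; $E^0_{\mathrm{reg}}$ is the set of regular vertices. Vertices are paths of length $0$. A cycle is a closed path $e_1\cdots e_n$ ($n\ge1$) with $s(e_i)\neq s(e_j)$ for $i\ne j$; a vertex connects to a cycle if there is a path from it to a vertex of the cycle. A sandpile graph is a finite directed graph with a unique sink (also denoted $s$) such that from every vertex there is a path to $s$. Its sandpile monoid is the commutative monoid $$\mathrm{SP}(E)=\langle v\mid v\in E^0\rangle\big/\big\langle s=0;\ |s^{-1}(v)|\,v=\textstyle\sum_{e\in s^{-1}(v)}r(e)\ \text{for all } v\in E^0\setminus\{s\}\big\rangle,$$ the quotient of the free commutative monoid on $E^0$ by the congruence generated by these relations. The same symbol denotes an element of the free commutative monoid and its class. The support $\mathrm{supp}(\alpha)\subseteq E^0$ of an element $\alpha$ of the free commutative monoid is the set of vertices appearing in its canonical expression; for $x\in\mathrm{SP}(E)$, $\mathrm{supp}(x)$ is the support of an element of the free commutative monoid representing $x$ (for $x\ne0$ the closure $\overline{\mathrm{supp}(x)}$ defined below does not depend on the representative). $H\subseteq E^0$ is hereditary if $s(e)\in H$ implies $r(e)\in H$ for all $e\in E^1$; it is saturated if $v\in E^0_{\mathrm{reg}}$ and $r(s^{-1}(v))\subseteq H$ imply $v\in H$. $\overline{H}$ is the smallest hereditary saturated subset containing $H$. For a nonempty hereditary saturated $H$, $E_H$ is the graph with $E_H^0=H$,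 $E_H^1=\{e\in E^1\mid s(e)\in H\}$ and restricted source and range maps; it is a sandpile graph, and $\mathrm{SP}(E_H)$ is viewed as a submonoid of $\mathrm{SP}(E)$ via $x\mapsto x$. The set $S_E$ is nonempty, hereditary and saturated. For a commutative monoid $M$, put $x\le y$ iff $y=x+m$ for some $m\in M$. The archimedean equivalence relation is: $x\asymp y$ iff $x\le my$ and $y\le nx$ for some $m,n\in\mathbb{N}$; the archimedean class of $x$ is $[x]=\{y\in M\mid y\asymp x\}$. $\mathrm{Idem}(M)$ is the set of idempotents ($m+m=m$), ordered by $\le$. A maximal subgroup of $M$ is the unit group of the monoid $x+M$ (with identity $x$) for some $x\in\mathrm{Idem}(M)$. The Grothendieck group $G(M)$ of a commutative semigroup $M$ is the set of classes $[(m_1,m_2)]_0$ of $M\times M$ under $(m_1,m_2)\sim(n_1,n_2)$ iff $m_1+n_2+x=m_2+n_1+x$ for some $x\in M$, with componentwise addition. The sandpile group of a sandpile graph $F$ is $G(F):=G(\mathrm{SP}(F))$; it is identified with the smallest ideal $\bigcap_{x\in\mathrm{SP}(F)}(x+\mathrm{SP}(F))$ of $\mathrm{SP}(F)$, i.e. with the set of its recurrent elements (elements $a$ such that for every $c\in\mathrm{SP}(F)$ there is $y\in\mathrm{SP}(F)$ with $a=c+y$). The direct limit in (3) is taken along the group homomorphisms $G([e])\to G([f])$ for idempotents $e\le f$ induced by the semigroup homomorphisms $[e]\to[f]$, $y\mapsto f+y$. *)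

theory Defs
  imports
    "HOL-Library.Disjoint_Sets"
    "HOL-Algebra.Divisibility"
    "HOL-Algebra.FiniteProduct"
    "HOL-Algebra.Coset"
    "Graph_Theory.Arc_Walk"
begin

text \<open>Sources and ranges of edges are \<^const>\<open>tail\<close> and \<^const>\<open>head\<close>; loops and parallel
  edges are allowed.\<close>

definition is_sink :: "('v, 'e) pre_digraph \<Rightarrow> 'v \<Rightarrow> bool" where
  "is_sink E v \<longleftrightarrow> v \<in> verts E \<and> out_arcs E v = {}"

definition is_regular :: "('v, 'e) pre_digraph \<Rightarrow> 'v \<Rightarrow> bool" where
  "is_regular E v \<longleftrightarrow> v \<in> verts E \<and> \<not> is_sink E v \<and> finite (out_arcs E v)"

locale sandpile_graph = fin_digraph E for E :: "('v, 'e) pre_digraph" +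
  assumes unique_sink: "\<exists>!s. is_sink E s"
    and reaches_sink: "\<And>v s. v \<in> verts E \<Longrightarrow> is_sink E s \<Longrightarrow> v \<rightarrow>\<^sup>*\<^bsub>E\<^esub> s"

definition hereditary :: "('v, 'e) pre_digraph \<Rightarrow> 'v set \<Rightarrow> bool" where
  "hereditary E H \<longleftrightarrow> H \<subseteq> verts E \<and> (\<forall>e\<in>arcs E. tail E e \<in> H \<longrightarrow> head E e \<in> H)"

definition saturated :: "('v, 'e) pre_digraph \<Rightarrow> 'v set \<Rightarrow> bool" where
  "saturated E H \<longleftrightarrow> H \<subseteq> verts E \<and>
     (\<forall>v. is_regular E v \<and> head E ` out_arcs E v \<subseteq> H \<longrightarrow> v \<in> H)"

definition hs_closure :: "('v, 'e) pre_digraph \<Rightarrow> 'v set \<Rightarrow> 'v set" where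
  "hs_closure E H = \<Inter> {K. hereditary E K \<and> saturated E K \<and> H \<subseteq> K}"

text \<open>The graph \<open>E\<^sub>H\<close>.\<close>

definition restrict_graph :: "('v, 'e) pre_digraph \<Rightarrow> 'v set \<Rightarrow> ('v, 'e) pre_digraph" where
  "restrict_graph E H =
     \<lparr>verts = H, arcs = {e \<in> arcs E. tail E e \<in> H}, tail = tail E, head = head E\<rparr>"

text \<open>The library's \<^const>\<open>pre_digraph.cycle\<close> demands that the ranges of the edges be distinct;
  on a closed path the ranges are the sources rotated by one position, so this is the same as
  distinctness of the sources. Loops are cycles.\<close>

definition connects_to_cycle :: "('v, 'e) pre_digraph \<Rightarrow> 'v \<Rightarrow> bool" where
  "connects_to_cycle E v \<longleftrightarrow>
     (\<exists>p. pre_digraph.cycle E p \<and> (\<exists>e\<in>set p. v \<rightarrow>\<^sup>*\<^bsub>E\<^esub> tail E e))"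

definition acyclic_part :: "('v, 'e) pre_digraph \<Rightarrow> 'v set" where
  "acyclic_part E = {v \<in> verts E. \<not> connects_to_cycle E v}"

text \<open>The free commutative monoid on the vertices consists of the multisets over \<^term>\<open>verts E\<close>;
  the support of such a multiset is its \<^const>\<open>set_mset\<close>.\<close>

definition free_elems :: "('v, 'e) pre_digraph \<Rightarrow> 'v multiset set" where
  "free_elems E = {\<alpha>. set_mset \<alpha> \<subseteq> verts E}"

inductive_set sp_cong :: "('v, 'e) pre_digraph \<Rightarrow> ('v multiset \<times> 'v multiset) set"
  for E :: "('v, 'e) pre_digraph" where
  sink: "is_sink E s \<Longrightarrow> ({#s#}, {#}) \<in> sp_cong E"
| topple: "v \<in> verts E \<Longrightarrow> \<not> is_sink E v \<Longrightarrow>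
     (replicate_mset (card (out_arcs E v)) v, image_mset (head E) (mset_set (out_arcs E v)))
       \<in> sp_cong E"
| refl: "\<alpha> \<in> free_elems E \<Longrightarrow> (\<alpha>, \<alpha>) \<in> sp_cong E"
| sym: "(\<alpha>, \<beta>) \<in> sp_cong E \<Longrightarrow> (\<beta>, \<alpha>) \<in> sp_cong E"
| trans: "(\<alpha>, \<beta>) \<in> sp_cong E \<Longrightarrow> (\<beta>, \<gamma>) \<in> sp_cong E \<Longrightarrow> (\<alpha>, \<gamma>) \<in> sp_cong E"
| add: "(\<alpha>, \<beta>) \<in> sp_cong E \<Longrightarrow> (\<gamma>, \<delta>) \<in> sp_cong E \<Longrightarrow> (\<alpha> + \<gamma>, \<beta> + \<delta>) \<in> sp_cong E"

text \<open>The sandpile monoid, in the multiplicative notation of HOL-Algebra: \<open>\<otimes>\<close> is addition,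
  \<open>\<one>\<close> is \<open>0\<close>, and \<open>y [^] n\<close> is \<open>ny\<close>. An element is a congruence class, i.e. the set of
  the multisets representing it. A union over all representatives, here and below, is an operation
  on classes that is constant on the representatives.\<close>

definition SP :: "('v, 'e) pre_digraph \<Rightarrow> 'v multiset set monoid" where
  "SP E = \<lparr>carrier = free_elems E // sp_cong E,
     monoid.mult = (\<lambda>A B. \<Union>\<alpha>\<in>A. \<Union>\<beta>\<in>B. sp_cong E `` {\<alpha> + \<beta>}),
     one = sp_cong E `` {{#}}\<rparr>"

text \<open>The map \<open>x \<mapsto> x\<close> from the sandpile monoid of \<open>E\<^sub>H\<close> to that of \<open>E\<close>.\<close>

definition sp_incl :: "('v, 'e) pre_digraph \<Rightarrow> 'v multiset set \<Rightarrow> 'v multiset set" where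
  "sp_incl E A = (\<Union>\<alpha>\<in>A. sp_cong E `` {\<alpha>})"

text \<open>The algebraic preorder \<open>x \<le> y\<close>, i.e. \<open>y = x + m\<close> for some \<open>m\<close>, is the library's
  divisibility relation \<^const>\<open>factor\<close>.\<close>

definition idempotents :: "('a, 'b) monoid_scheme \<Rightarrow> 'a set" where
  "idempotents M = {m \<in> carrier M. m \<otimes>\<^bsub>M\<^esub> m = m}"

definition archi_equiv :: "('a, 'b) monoid_scheme \<Rightarrow> 'a \<Rightarrow> 'a \<Rightarrow> bool" where
  "archi_equiv M x y \<longleftrightarrow>
     (\<exists>(m::nat) (n::nat). x divides\<^bsub>M\<^esub> (y [^]\<^bsub>M\<^esub> m) \<and> y divides\<^bsub>M\<^esub> (x [^]\<^bsub>M\<^esub> n))"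

definition archi_class :: "('a, 'b) monoid_scheme \<Rightarrow> 'a \<Rightarrow> 'a set" where
  "archi_class M x = {y \<in> carrier M. archi_equiv M y x}"

definition subsemigroup :: "'a set \<Rightarrow> ('a, 'b) monoid_scheme \<Rightarrow> bool" where
  "subsemigroup S M \<longleftrightarrow> S \<noteq> {} \<and> S \<subseteq> carrier M \<and> (\<forall>x\<in>S. \<forall>y\<in>S. x \<otimes>\<^bsub>M\<^esub> y \<in> S)"

text \<open>\<open>[x]\<close> as a semigroup; the field \<^const>\<open>one\<close> is meaningless here and is not used by
  the Grothendieck construction below.\<close>

definition archi_semigroup :: "('a, 'b) monoid_scheme \<Rightarrow> 'a \<Rightarrow> ('a, 'b) monoid_scheme" where
  "archi_semigroup M x = M\<lparr>carrier := archi_class M x\<rparr>"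

text \<open>\<open>x + [x]\<close> with identity \<open>x\<close>.\<close>

definition archi_group :: "('a, 'b) monoid_scheme \<Rightarrow> 'a \<Rightarrow> 'a monoid" where
  "archi_group M x =
     \<lparr>carrier = x <#\<^bsub>M\<^esub> archi_class M x, monoid.mult = monoid.mult M, one = x\<rparr>"

text \<open>\<open>x + M\<close> with identity \<open>x\<close>.\<close>

definition local_monoid :: "('a, 'b) monoid_scheme \<Rightarrow> 'a \<Rightarrow> 'a monoid" where
  "local_monoid M x =
     \<lparr>carrier = x <#\<^bsub>M\<^esub> carrier M, monoid.mult = monoid.mult M, one = x\<rparr>"

definition maximal_subgroups :: "('a, 'b) monoid_scheme \<Rightarrow> 'a monoid set" where
  "maximal_subgroups M = {units_of (local_monoid M x) | x. x \<in> idempotents M}"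

definition smallest_ideal :: "('a, 'b) monoid_scheme \<Rightarrow> 'a set" where
  "smallest_ideal M = (\<Inter>x\<in>carrier M. x <#\<^bsub>M\<^esub> carrier M)"

text \<open>The group structure on the smallest ideal (the recurrent elements, for a sandpile monoid);
  its identity is the idempotent it contains.\<close>

definition recurrent_group :: "('a, 'b) monoid_scheme \<Rightarrow> 'a monoid" where
  "recurrent_group M =
     \<lparr>carrier = smallest_ideal M, monoid.mult = monoid.mult M,
      one = (THE e. e \<in> smallest_ideal M \<and> e \<in> idempotents M)\<rparr>"

definition groth_rel :: "('a, 'b) monoid_scheme \<Rightarrow> (('a \<times> 'a) \<times> ('a \<times> 'a)) set" where
  "groth_rel M = {((m\<^sub>1, m\<^sub>2), (n\<^sub>1, n\<^sub>2)).
     m\<^sub>1 \<in> carrier M \<and> m\<^sub>2 \<in> carrier M \<and> n\<^sub>1 \<in> carrier M \<and> n\<^sub>2 \<in> carrier M \<and>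
     (\<exists>x\<in>carrier M. m\<^sub>1 \<otimes>\<^bsub>M\<^esub> n\<^sub>2 \<otimes>\<^bsub>M\<^esub> x = m\<^sub>2 \<otimes>\<^bsub>M\<^esub> n\<^sub>1 \<otimes>\<^bsub>M\<^esub> x)}"

definition grothendieck :: "('a, 'b) monoid_scheme \<Rightarrow> ('a \<times> 'a) set monoid" where
  "grothendieck M = \<lparr>carrier = (carrier M \<times> carrier M) // groth_rel M,
     monoid.mult = (\<lambda>A B. \<Union>(a\<^sub>1, a\<^sub>2)\<in>A. \<Union>(b\<^sub>1, b\<^sub>2)\<in>B.
       groth_rel M `` {(a\<^sub>1 \<otimes>\<^bsub>M\<^esub> b\<^sub>1, a\<^sub>2 \<otimes>\<^bsub>M\<^esub> b\<^sub>2)}),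
     one = (\<Union>m\<in>carrier M. groth_rel M `` {(m, m)})\<rparr>"

text \<open>The map between Grothendieck groups induced by a homomorphism \<open>f\<close> with codomain \<open>N\<close>.\<close>

definition groth_map ::
  "('c, 'd) monoid_scheme \<Rightarrow> ('a \<Rightarrow> 'c) \<Rightarrow> ('a \<times> 'a) set \<Rightarrow> ('c \<times> 'c) set" where
  "groth_map N f A = (\<Union>(a\<^sub>1, a\<^sub>2)\<in>A. groth_rel N `` {(f a\<^sub>1, f a\<^sub>2)})"

text \<open>The canonical map of a monoid into its Grothendieck group.\<close>

definition groth_of :: "('a, 'b) monoid_scheme \<Rightarrow> 'a \<Rightarrow> ('a \<times> 'a) set" where
  "groth_of M a = groth_rel M `` {(a, \<one>\<^bsub>M\<^esub>)}"

definition sandpile_group ::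
  "('v, 'e) pre_digraph \<Rightarrow> ('v multiset set \<times> 'v multiset set) set monoid" where
  "sandpile_group F = grothendieck (SP F)"

text \<open>The equality \<open>K = G(E\<^sub>H)\<close> for a group \<open>K\<close> inside the sandpile monoid of \<open>E\<close>, read
  through the two identifications it involves: \<open>G(E\<^sub>H)\<close> with the smallest ideal of the sandpile
  monoid of \<open>E\<^sub>H\<close> by the canonical map, and the latter monoid with a submonoid of the sandpile
  monoid of \<open>E\<close> by \<open>x \<mapsto> x\<close>. In particular the carrier of \<open>K\<close> is the image of that ideal.\<close>

definition eq_sandpile_group ::
  "('v, 'e) pre_digraph \<Rightarrow> 'v set \<Rightarrow> 'v multiset set monoid \<Rightarrow> bool" where
  "eq_sandpile_group E H K \<longleftrightarrow>
     groth_of (SP (restrict_graph E H))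
       \<in> iso (recurrent_group (SP (restrict_graph E H))) (sandpile_group (restrict_graph E H)) \<and>
     sp_incl E \<in> iso (recurrent_group (SP (restrict_graph E H))) K"

text \<open>The direct limit of a system of groups \<open>G i\<close>, \<open>i \<in> I\<close>, with transition maps
  \<open>\<phi> i j : G i \<rightarrow> G j\<close> for \<open>leq i j\<close>, over a directed index set: the disjoint union of the
  groups modulo eventual equality.\<close>

definition dirlim_rel ::
  "'i set \<Rightarrow> ('i \<Rightarrow> 'i \<Rightarrow> bool) \<Rightarrow> ('i \<Rightarrow> ('a, 'b) monoid_scheme) \<Rightarrow> ('i \<Rightarrow> 'i \<Rightarrow> 'a \<Rightarrow> 'a)
     \<Rightarrow> (('i \<times> 'a) \<times> ('i \<times> 'a)) set" where
  "dirlim_rel I leq G \<phi> = {((i, a), (j, b)).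
     i \<in> I \<and> a \<in> carrier (G i) \<and> j \<in> I \<and> b \<in> carrier (G j) \<and>
     (\<exists>k\<in>I. leq i k \<and> leq j k \<and> \<phi> i k a = \<phi> j k b)}"

definition dirlim ::
  "'i set \<Rightarrow> ('i \<Rightarrow> 'i \<Rightarrow> bool) \<Rightarrow> ('i \<Rightarrow> ('a, 'b) monoid_scheme) \<Rightarrow> ('i \<Rightarrow> 'i \<Rightarrow> 'a \<Rightarrow> 'a)
     \<Rightarrow> ('i \<times> 'a) set monoid" where
  "dirlim I leq G \<phi> =
     \<lparr>carrier = (SIGMA i:I. carrier (G i)) // dirlim_rel I leq G \<phi>,
      monoid.mult = (\<lambda>A B. \<Union>(i, a)\<in>A. \<Union>(j, b)\<in>B. \<Union>k\<in>{k \<in> I. leq i k \<and> leq j k}.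
        dirlim_rel I leq G \<phi> `` {(k, \<phi> i k a \<otimes>\<^bsub>G k\<^esub> \<phi> j k b)}),
      one = (\<Union>i\<in>I. dirlim_rel I leq G \<phi> `` {(i, \<one>\<^bsub>G i\<^esub>)})\<rparr>"

text \<open>\<open>L\<close> with the maps \<open>\<psi> i : G i \<rightarrow> L\<close> is the direct limit: the \<open>\<psi> i\<close> induce an isomorphism
  from the group just constructed to \<open>L\<close>.\<close>

definition is_dirlim ::
  "'i set \<Rightarrow> ('i \<Rightarrow> 'i \<Rightarrow> bool) \<Rightarrow> ('i \<Rightarrow> ('a, 'b) monoid_scheme) \<Rightarrow> ('i \<Rightarrow> 'i \<Rightarrow> 'a \<Rightarrow> 'a)
     \<Rightarrow> ('c, 'd) monoid_scheme \<Rightarrow> ('i \<Rightarrow> 'a \<Rightarrow> 'c) \<Rightarrow> bool" where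
  "is_dirlim I leq G \<phi> L \<psi> \<longleftrightarrow>
     (\<exists>h \<in> iso (dirlim I leq G \<phi>) L.
        \<forall>i\<in>I. \<forall>a\<in>carrier (G i). h (dirlim_rel I leq G \<phi> `` {(i, a)}) = \<psi> i a)"

text \<open>The sum of all idempotents; \<^const>\<open>finprod\<close> is the intended sum because the sandpile monoid
  of a sandpile graph is finite.\<close>

definition e_max :: "('a, 'b) monoid_scheme \<Rightarrow> 'a" where
  "e_max M = finprod M (\<lambda>x. x) (idempotents M)"

end

(* A finite commutative monoid splits into archimedean classes, one for each idempotent e: some
   multiple of every element is idempotent, and two idempotents dividing multiples of each other
   are equal. Adding e maps the class [e] onto its group e + [e], which is both the Grothendieck
   group of [e] and the unit group of e + M; the index set of the direct limit has the largest
   element e_max, whose class contains e_max + M.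

   For sandpile monoids, regard the relations as a rewriting system (chip-firing). It is confluent,
   so two configurations are congruent iff they have a common descendant. If H is nonempty,
   hereditary and saturated, firing neither enters nor leaves the configurations supported on H;
   hence SP(E_H) embeds into SP(E) and contains every summand of its elements. For an idempotent x
   with support A, the vertices below x form a hereditary saturated set containing A, so x is the
   largest idempotent of SP(E_H), where H is the closure of A, and x + [x] is the smallest ideal of
   SP(E_H). The case x = 0 is x represented by the sink, whose closure consists of the vertices
   that do not connect to a cycle. *)
theory Submission
  imports Defs "HOL-Library.Confluence"
begin

section \<open>Archimedean classes in commutative monoids\<close>

text \<open>Finiteness of SP(E), which produces the idempotents, is not visible from the
  presentation. It comes from the paths to the sink: they give a weight that drops with every
  firing, so each configuration fires down to a stable one, and in a stable configuration the number
  of chips at each of the finitely many vertices is bounded.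

  The obstacle to comparing SP(E_H) with SP(E) is that a derivation of a congruence may use
  relations in both directions and at any place, so it says little about supports. A common
  descendant replaces it by two forward runs. Heredity is what following a run forwards takes;
  saturation, together with the sink being in H, is what tracing a run backwards takes.

  At an idempotent e the multiples in the archimedean relation disappear, because ne = e for n >= 1:
  lying below a multiple of e means lying below e. What remains is a calculus of the elements below
  e, in which the inverse of y is a complement c with y + c = e.\<close>

context comm_monoid
begin

lemma idempotentsD:
  assumes "e \<in> idempotents G"
  shows "e \<in> carrier G" "e \<otimes> e = e"
  using assms by (auto simp: idempotents_def)

lemma divides_idem_absorb:
  assumes "e \<in> idempotents G" "e divides b"
  shows "e \<otimes> b = b"
proof -
  obtain c where "c \<in> carrier G" "b = e \<otimes> c"
    using assms(2) by (auto simp: factor_def)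
  then show ?thesis
    using idempotentsD[OF assms(1)] by (metis m_assoc)
qed

lemma idem_pow_Suc:
  assumes "e \<in> idempotents G"
  shows "e [^] Suc n = e"
  using idempotentsD[OF assms] by (induction n) auto

lemma divides_idem_pow:
  fixes n :: nat
  assumes "e \<in> idempotents G" "x \<in> carrier G" "x divides (e [^] n)"
  shows "x divides e"
proof (cases n)
  case 0
  then obtain c where c: "c \<in> carrier G" "\<one> = x \<otimes> c"
    using assms(3) by (auto simp: factor_def)
  then have "e = x \<otimes> (c \<otimes> e)"
    using assms(2) idempotentsD[OF assms(1)] by (metis l_one m_assoc)
  then show ?thesis
    using c idempotentsD[OF assms(1)] by (intro dividesI) auto
next
  case (Suc k)
  then show ?thesis
    using assms idem_pow_Suc by simp
qed

text \<open>Divisibility is in general only a preorder; here each idempotent absorbs the other, so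
  both are equal to \<open>e \<otimes> f\<close>.\<close>

lemma idempotents_divides_antisym:
  assumes "e \<in> idempotents G" "f \<in> idempotents G" "e divides f" "f divides e"
  shows "e = f"
  using divides_idem_absorb[OF assms(1,3)] divides_idem_absorb[OF assms(2,4)]
    idempotentsD[OF assms(1)] idempotentsD[OF assms(2)] m_comm by metis

lemma divides_pow:
  assumes "a \<in> carrier G" "a divides b"
  shows "(a [^] (n::nat)) divides (b [^] n)"
proof -
  obtain c where "c \<in> carrier G" "b = a \<otimes> c"
    using assms(2) by (auto simp: factor_def)
  then show ?thesis
    using assms(1) pow_mult_distrib[of a c n] m_comm by (intro dividesI[of "c [^] n"]) auto
qed

text \<open>The product of the two complements is a complement of the product, because
  \<open>e \<otimes> e = e\<close>.\<close>

lemma mult_divides_idem: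
  assumes e: "e \<in> idempotents G"
    and ab: "a \<in> carrier G" "b \<in> carrier G" "a divides e" "b divides e"
  shows "(a \<otimes> b) divides e"
proof -
  obtain c d where cd: "c \<in> carrier G" "e = a \<otimes> c" "d \<in> carrier G" "e = b \<otimes> d"
    using ab by (auto simp: factor_def)
  have "e = (a \<otimes> c) \<otimes> (b \<otimes> d)"
    using cd idempotentsD(2)[OF e] by metis
  also have "\<dots> = (a \<otimes> b) \<otimes> (c \<otimes> d)"
    using ab cd by (simp add: m_ac)
  finally show ?thesis
    using cd by (intro dividesI[of "c \<otimes> d"]) auto
qed

lemma archi_equiv_sym: "archi_equiv G x y \<Longrightarrow> archi_equiv G y x"
  by (auto simp: archi_equiv_def)

lemma archi_equiv_refl: "x \<in> carrier G \<Longrightarrow> archi_equiv G x x"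
  unfolding archi_equiv_def by (intro exI[of _ 1]) auto

lemma archi_equiv_trans:
  assumes "archi_equiv G x y" "archi_equiv G y z"
    and carr: "x \<in> carrier G" "y \<in> carrier G" "z \<in> carrier G"
  shows "archi_equiv G x z"
proof -
  have *: "\<exists>k::nat. a divides (c [^] k)"
    if "a divides (b [^] m)" "b divides (c [^] n)"
      and "a \<in> carrier G" "b \<in> carrier G" "c \<in> carrier G" for a b c and m n :: nat
  proof -
    have "(b [^] m) divides ((c [^] n) [^] m)"
      using that by (intro divides_pow)
    then have "a divides (c [^] (n * m))"
      using that divides_trans[of a "b [^] m"] by (simp add: nat_pow_pow)
    then show ?thesis by blast
  qed
  show ?thesis
    using assms(1,2) * carr unfolding archi_equiv_def by meson
qed

lemma archi_equiv_idem_eq: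
  assumes "archi_equiv G e f" "e \<in> idempotents G" "f \<in> idempotents G"
  shows "e = f"
  using assms divides_idem_pow idempotents_divides_antisym idempotentsD
  unfolding archi_equiv_def by metis

lemma archi_class_carrier: "archi_class G x \<subseteq> carrier G"
  by (auto simp: archi_class_def)

text \<open>The exponents of the upper bounds add up. In the other direction \<open>x\<close> lies
  below a power of \<open>y\<close>, hence below the same power of
  \<open>y \<otimes> z\<close>.\<close>

lemma subsemigroup_archi_class:
  assumes "x \<in> carrier G"
  shows "subsemigroup (archi_class G x) G"
  unfolding subsemigroup_def
proof (intro conjI ballI)
  show "archi_class G x \<noteq> {}"
    using assms archi_equiv_refl by (auto simp: archi_class_def)
  show "archi_class G x \<subseteq> carrier G" by (rule archi_class_carrier)
  fix y z assume y: "y \<in> archi_class G x" and z: "z \<in> archi_class G x"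
  obtain m n k l :: nat where
    *: "y \<in> carrier G" "z \<in> carrier G" "y divides (x [^] m)" "x divides (y [^] n)"
       "z divides (x [^] k)"
    using y z by (auto simp: archi_class_def archi_equiv_def)
  obtain c d where cd: "c \<in> carrier G" "x [^] m = y \<otimes> c" "d \<in> carrier G" "x [^] k = z \<otimes> d"
    using * by (auto simp: factor_def)
  have "x [^] (m + k) = (y \<otimes> z) \<otimes> (c \<otimes> d)"
    using * assms cd by (simp add: nat_pow_mult[symmetric] m_ac)
  then have 1: "(y \<otimes> z) divides (x [^] (m + k))"
    using cd by (intro dividesI[of "c \<otimes> d"]) auto
  have "(y [^] n) divides ((y \<otimes> z) [^] n)"
    using * by (intro divides_pow) auto
  then have "x divides ((y \<otimes> z) [^] n)"
    using * assms divides_trans by (meson nat_pow_closed m_closed)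
  with 1 show "y \<otimes> z \<in> archi_class G x"
    using * by (auto simp: archi_class_def archi_equiv_def)
qed

lemma archi_class_idem_iff:
  assumes "e \<in> idempotents G"
  shows "y \<in> archi_class G e \<longleftrightarrow>
    y \<in> carrier G \<and> y divides e \<and> (\<exists>n::nat. e divides (y [^] n))"
proof -
  have "y divides (e [^] (1::nat))" if "y divides e"
    using that idempotentsD[OF assms] by simp
  then show ?thesis
    using divides_idem_pow[OF assms] unfolding archi_class_def archi_equiv_def by blast
qed

lemma idem_mem_archi_class:
  assumes "e \<in> idempotents G"
  shows "e \<in> archi_class G e"
  using idempotentsD[OF assms] archi_equiv_refl by (auto simp: archi_class_def)

lemma absorbing_mem_archi_class:
  assumes "e \<in> idempotents G" "y \<in> carrier G" "y divides e" "e \<otimes> y = y"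
  shows "y \<in> archi_class G e"
proof -
  have "e divides (y [^] (1::nat))"
    using assms(2,4) by (intro dividesI[of y]) auto
  then show ?thesis
    using assms(2,3) unfolding archi_class_idem_iff[OF assms(1)] by blast
qed

text \<open>A complement \<open>c\<close> found in the monoid may lie outside the class. But
  \<open>e \<otimes> c\<close> absorbs \<open>e\<close> and is still a complement, since
  \<open>y \<otimes> (e \<otimes> c) = e \<otimes> e\<close>. This is the source of all inverses
  below.\<close>

lemma archi_class_cofactor:
  assumes e: "e \<in> idempotents G" and y: "y \<in> archi_class G e"
  obtains c where "c \<in> archi_class G e" "y \<otimes> c = e"
proof -
  obtain c where c: "c \<in> carrier G" "e = y \<otimes> c" and yc: "y \<in> carrier G"
    using y e by (auto simp: archi_class_idem_iff factor_def)
  have ee: "e \<in> carrier G" "e \<otimes> e = e" using idempotentsD[OF e] .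
  have "y \<otimes> (e \<otimes> c) = e"
    using c yc ee m_lcomm by metis
  moreover have "e \<otimes> c \<in> archi_class G e"
  proof (rule absorbing_mem_archi_class[OF e])
    show "(e \<otimes> c) divides e"
      using calculation yc c ee m_comm by (intro dividesI[of y]) auto
    show "e \<otimes> (e \<otimes> c) = e \<otimes> c"
      using c ee by (metis m_assoc)
  qed (use c ee in auto)
  ultimately show ?thesis using that by blast
qed

text \<open>A unit of the local monoid absorbs \<open>e\<close> and divides it, which places it in
  the class; conversely, complements inside the class give inverses. The equality is one of records,
  so the maximal subgroups are determined as a set and not only up to isomorphism.\<close>

lemma archi_group_eq_units:
  assumes e: "e \<in> idempotents G"
  shows "units_of (local_monoid G e) = archi_group G e"
proof -
  have ee: "e \<in> carrier G" "e \<otimes> e = e" using idempotentsD[OF e] .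
  have "Units (local_monoid G e) = e <# archi_class G e"
  proof (intro equalityI subsetI)
    fix u assume "u \<in> Units (local_monoid G e)"
    then obtain a b where ab: "a \<in> carrier G" "b \<in> carrier G" "u = e \<otimes> a" "u \<otimes> (e \<otimes> b) = e"
      by (auto simp: Units_def local_monoid_def l_coset_def)
    have eu: "e \<otimes> u = u"
      using ab ee by (metis m_assoc)
    have "u divides e"
      using ab ee by (intro dividesI[of "e \<otimes> b"]) auto
    then have "u \<in> archi_class G e"
      using ab ee eu by (intro absorbing_mem_archi_class[OF e]) auto
    then show "u \<in> e <# archi_class G e"
      using eu unfolding l_coset_def by force
  next
    fix u assume "u \<in> e <# archi_class G e"
    then obtain y where y: "y \<in> archi_class G e" "u = e \<otimes> y"
      by (auto simp: l_coset_def)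
    obtain c where c: "c \<in> archi_class G e" "y \<otimes> c = e"
      using archi_class_cofactor[OF e y(1)] .
    have carr: "y \<in> carrier G" "c \<in> carrier G"
      using y c by (auto simp: archi_class_def)
    have "(e \<otimes> y) \<otimes> (e \<otimes> c) = (e \<otimes> e) \<otimes> (y \<otimes> c)"
      using carr ee(1) by (simp add: m_ac)
    then have uc: "u \<otimes> (e \<otimes> c) = e" "(e \<otimes> c) \<otimes> u = e"
      using y c carr ee by (auto simp: m_comm)
    show "u \<in> Units (local_monoid G e)"
      unfolding Units_def local_monoid_def l_coset_def
      using uc y(2) carr by force
  qed
  then show ?thesis
    by (simp add: units_of_def archi_group_def local_monoid_def)
qed

lemma maximal_subgroups_eq:
  "maximal_subgroups G = {archi_group G x | x. x \<in> idempotents G}"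
  unfolding maximal_subgroups_def using archi_group_eq_units by (metis (lifting))

end

section \<open>Grothendieck groups of subsemigroups\<close>

text \<open>An archimedean class need not contain the identity of the monoid, so the Grothendieck
  group is treated for nonempty subsemigroups. Taking \<open>carrier G\<close> for \<open>S\<close>
  gives the group of the whole monoid.\<close>

locale comm_subsemigroup = comm_monoid G for G (structure) +
  fixes S
  assumes subsemigroup: "subsemigroup S G"
begin

lemma nonempty: "S \<noteq> {}"
  and mem_carrier: "a \<in> S \<Longrightarrow> a \<in> carrier G"
  and mult_mem: "a \<in> S \<Longrightarrow> b \<in> S \<Longrightarrow> a \<otimes> b \<in> S"
  using subsemigroup by (auto simp: subsemigroup_def)

abbreviation R where "R \<equiv> groth_rel (G\<lparr>carrier := S\<rparr>)"

lemma groth_rel_iff: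
  "((a, b), (c, d)) \<in> R \<longleftrightarrow>
    a \<in> S \<and> b \<in> S \<and> c \<in> S \<and> d \<in> S \<and> (\<exists>x\<in>S. a \<otimes> d \<otimes> x = b \<otimes> c \<otimes> x)"
  by (simp add: groth_rel_def)

lemma equiv_groth_rel: "equiv (S \<times> S) R"
proof (rule equivI)
  show "R \<subseteq> (S \<times> S) \<times> (S \<times> S)" by (auto simp: groth_rel_def)
  show "refl_on (S \<times> S) R"
    using nonempty m_comm mem_carrier by (auto simp: refl_on_def groth_rel_iff)
  show "sym R"
    by (auto simp: sym_def groth_rel_iff) (metis m_comm mem_carrier)
  show "trans R"
  proof (rule transI, clarify)
    fix a b c d e f
    assume "((a, b), (c, d)) \<in> R" "((c, d), (e, f)) \<in> R"
    then obtain x y where S: "a \<in> S" "b \<in> S" "c \<in> S" "d \<in> S" "e \<in> S" "f \<in> S" "x \<in> S" "y \<in> S"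
      and xy: "a \<otimes> d \<otimes> x = b \<otimes> c \<otimes> x" "c \<otimes> f \<otimes> y = d \<otimes> e \<otimes> y"
      by (auto simp: groth_rel_iff)
    have C: "a \<in> carrier G" "b \<in> carrier G" "c \<in> carrier G" "d \<in> carrier G"
      "e \<in> carrier G" "f \<in> carrier G" "x \<in> carrier G" "y \<in> carrier G"
      using S mem_carrier by auto
    \<comment> \<open>Without cancellation the middle entry \<open>d\<close> cannot be removed; it
      becomes part of the witness.\<close>
    have "a \<otimes> f \<otimes> (d \<otimes> x \<otimes> y) = (a \<otimes> d \<otimes> x) \<otimes> (f \<otimes> y)"
      using C by (simp add: m_ac)
    also have "\<dots> = b \<otimes> x \<otimes> (c \<otimes> f \<otimes> y)"
      unfolding xy(1) using C by (simp add: m_ac)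
    also have "\<dots> = b \<otimes> e \<otimes> (d \<otimes> x \<otimes> y)"
      unfolding xy(2) using C by (simp add: m_ac)
    finally show "((a, b), (e, f)) \<in> R"
      using S mult_mem by (auto simp: groth_rel_iff)
  qed
qed

text \<open>The formal difference of \<open>a\<close> and \<open>b\<close>.\<close>

definition gcls where "gcls a b = R `` {(a, b)}"

lemma gcls_eq_iff:
  assumes "a \<in> S" "b \<in> S" "c \<in> S" "d \<in> S"
  shows "gcls a b = gcls c d \<longleftrightarrow> (\<exists>x\<in>S. a \<otimes> d \<otimes> x = b \<otimes> c \<otimes> x)"
  unfolding gcls_def using assms eq_equiv_class_iff[OF equiv_groth_rel] by (simp add: groth_rel_iff)

lemma gcls_mem: "a \<in> S \<Longrightarrow> b \<in> S \<Longrightarrow> gcls a b \<in> carrier (grothendieck (G\<lparr>carrier := S\<rparr>))"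
  by (simp add: grothendieck_def gcls_def quotientI)

lemma gcls_cases:
  assumes "A \<in> carrier (grothendieck (G\<lparr>carrier := S\<rparr>))"
  obtains a b where "a \<in> S" "b \<in> S" "A = gcls a b"
  using assms by (auto simp: grothendieck_def gcls_def elim!: quotientE)

lemma gcls_union:
  assumes "\<And>c d c' d'. ((c, d), (c', d')) \<in> R \<Longrightarrow> F c d = F c' d'"
    and "a \<in> S" "b \<in> S"
  shows "(\<Union>(c, d)\<in>gcls a b. F c d) = F a b"
proof -
  have "congruent R (\<lambda>(c, d). F c d)"
    using assms(1) by (auto simp: congruent_def)
  from UN_equiv_class[OF equiv_groth_rel this, of "(a, b)"] show ?thesis
    using assms by (simp add: gcls_def)
qed

lemma gcls_mult:
  assumes "a \<in> S" "b \<in> S" "c \<in> S" "d \<in> S"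
  shows "gcls a b \<otimes>\<^bsub>grothendieck (G\<lparr>carrier := S\<rparr>)\<^esub> gcls c d = gcls (a \<otimes> c) (b \<otimes> d)"
proof -
  have cong: "gcls (p \<otimes> q) (r \<otimes> t) = gcls (p' \<otimes> q') (r' \<otimes> t')"
    if "((p, r), (p', r')) \<in> R" "((q, t), (q', t')) \<in> R" for p q r t p' q' r' t'
  proof -
    obtain x y where S: "p \<in> S" "r \<in> S" "p' \<in> S" "r' \<in> S" "q \<in> S" "t \<in> S" "q' \<in> S" "t' \<in> S"
      "x \<in> S" "y \<in> S"
      and xy: "p \<otimes> r' \<otimes> x = r \<otimes> p' \<otimes> x" "q \<otimes> t' \<otimes> y = t \<otimes> q' \<otimes> y"
      using \<open>((p, r), (p', r')) \<in> R\<close> \<open>((q, t), (q', t')) \<in> R\<close> by (auto simp: groth_rel_iff)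
    note C = S[THEN mem_carrier]
    have "(p \<otimes> q) \<otimes> (r' \<otimes> t') \<otimes> (x \<otimes> y) = (p \<otimes> r' \<otimes> x) \<otimes> (q \<otimes> t' \<otimes> y)"
      using C by (simp add: m_ac)
    also have "\<dots> = (r \<otimes> t) \<otimes> (p' \<otimes> q') \<otimes> (x \<otimes> y)"
      unfolding xy using C by (simp add: m_ac)
    finally show ?thesis
      using S mult_mem by (subst gcls_eq_iff) auto
  qed
  have refl: "((p, q), (p, q)) \<in> R" if "p \<in> S" "q \<in> S" for p q
    using equiv_groth_rel that by (auto simp: equiv_def refl_on_def)
  have "gcls a b \<otimes>\<^bsub>grothendieck (G\<lparr>carrier := S\<rparr>)\<^esub> gcls c d =
      (\<Union>(p, r)\<in>gcls a b. \<Union>(q, t)\<in>gcls c d. gcls (p \<otimes> q) (r \<otimes> t))"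
    by (simp add: grothendieck_def gcls_def)
  also have "\<dots> = (\<Union>(p, r)\<in>gcls a b. gcls (p \<otimes> c) (r \<otimes> d))"
  proof (rule SUP_cong, simp, clarify)
    fix p r assume "(p, r) \<in> gcls a b"
    then have "p \<in> S" "r \<in> S" by (auto simp: gcls_def groth_rel_iff)
    then show "(\<Union>(q, t)\<in>gcls c d. gcls (p \<otimes> q) (r \<otimes> t)) = gcls (p \<otimes> c) (r \<otimes> d)"
      using assms refl cong by (intro gcls_union) auto
  qed
  also have "\<dots> = gcls (a \<otimes> c) (b \<otimes> d)"
    using assms refl cong by (intro gcls_union) auto
  finally show ?thesis .
qed

lemma groth_map_gcls:
  assumes T: "comm_subsemigroup G T"
    and f: "\<And>a. a \<in> S \<Longrightarrow> f a \<in> T"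
    and hom: "\<And>a b. a \<in> S \<Longrightarrow> b \<in> S \<Longrightarrow> f (a \<otimes> b) = f a \<otimes> f b"
    and ab: "a \<in> S" "b \<in> S"
  shows "groth_map (G\<lparr>carrier := T\<rparr>) f (gcls a b) = comm_subsemigroup.gcls G T (f a) (f b)"
proof -
  interpret T: comm_subsemigroup G T by fact
  have "T.gcls (f c) (f d) = T.gcls (f c') (f d')" if "((c, d), (c', d')) \<in> R" for c d c' d'
  proof -
    obtain x where S: "c \<in> S" "d \<in> S" "c' \<in> S" "d' \<in> S" "x \<in> S"
      and x: "c \<otimes> d' \<otimes> x = d \<otimes> c' \<otimes> x"
      using \<open>((c, d), (c', d')) \<in> R\<close> by (auto simp: groth_rel_iff)
    have "f c \<otimes> f d' \<otimes> f x = f d \<otimes> f c' \<otimes> f x"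
      using S x mult_mem by (metis hom)
    then show ?thesis
      using S f by (subst T.gcls_eq_iff) auto
  qed
  then show ?thesis
    unfolding groth_map_def T.gcls_def[symmetric] using ab by (rule gcls_union)
qed

text \<open>An idempotent \<open>e\<close> below which all of \<open>S\<close> lies makes \<open>e + S\<close> a group, and the Grothendieck
  group cannot distinguish \<open>a\<close> from \<open>e + a\<close>.\<close>

lemma groth_iso:
  assumes e: "e \<in> S" "e \<otimes> e = e" and cof: "\<And>a. a \<in> S \<Longrightarrow> \<exists>c\<in>S. a \<otimes> c = e"
  shows "(\<lambda>a. gcls a e) \<in> iso \<lparr>carrier = e <# S, monoid.mult = monoid.mult G, one = e\<rparr>
           (grothendieck (G\<lparr>carrier := S\<rparr>))" (is "_ \<in> iso ?K _")
proof -
  have KS: "a \<in> S" "e \<otimes> a = a" if "a \<in> e <# S" for a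
    using that e mult_mem by (auto simp: l_coset_def m_assoc[symmetric] mem_carrier)
  have "(\<lambda>a. gcls a e) \<in> hom ?K (grothendieck (G\<lparr>carrier := S\<rparr>))"
    using KS e gcls_mem gcls_mult by (auto simp: hom_def Pi_def)
  moreover have "inj_on (\<lambda>a. gcls a e) (e <# S)"
  proof (rule inj_onI)
    fix a b assume K: "a \<in> e <# S" "b \<in> e <# S" and "gcls a e = gcls b e"
    then obtain x where x: "x \<in> S" "a \<otimes> e \<otimes> x = e \<otimes> b \<otimes> x"
      using gcls_eq_iff KS e by auto
    \<comment> \<open>A complement turns the witness \<open>x\<close> into \<open>e\<close>, which
      \<open>a\<close> and \<open>b\<close> absorb.\<close>
    obtain y where y: "y \<in> S" "x \<otimes> y = e"
      using cof x by auto
    have C: "a \<in> carrier G" "b \<in> carrier G" "x \<in> carrier G" "y \<in> carrier G" "e \<in> carrier G"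
      using K KS x y e mem_carrier by auto
    have "a \<otimes> (x \<otimes> y) = b \<otimes> (x \<otimes> y)"
      using x(2) KS[OF K(1)] KS[OF K(2)] C by (metis m_assoc m_comm)
    then show "a = b"
      using y KS[OF K(1)] KS[OF K(2)] C by (metis m_comm)
  qed
  moreover have "gcls a b \<in> (\<lambda>a. gcls a e) ` (e <# S)" if ab: "a \<in> S" "b \<in> S" for a b
  proof -
    \<comment> \<open>\<open>c\<close> acts as the negative of \<open>b\<close>: the difference of
      \<open>a\<close> and \<open>b\<close> is represented by
      \<open>e \<otimes> (a \<otimes> c)\<close>.\<close>
    obtain c where c: "c \<in> S" "b \<otimes> c = e"
      using cof ab by auto
    have C: "a \<in> carrier G" "b \<in> carrier G" "c \<in> carrier G" "e \<in> carrier G"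
      using ab c e mem_carrier by auto
    have "b \<otimes> (e \<otimes> (a \<otimes> c)) \<otimes> e = a \<otimes> e \<otimes> e \<otimes> (b \<otimes> c)"
      using C by (simp add: m_ac)
    also have "\<dots> = a \<otimes> e \<otimes> e"
      using C c e by (simp add: m_assoc)
    finally have "a \<otimes> e \<otimes> e = b \<otimes> (e \<otimes> (a \<otimes> c)) \<otimes> e" ..
    then have "gcls a b = gcls (e \<otimes> (a \<otimes> c)) e"
      using ab c e mult_mem by (subst gcls_eq_iff) auto
    moreover have "e \<otimes> (a \<otimes> c) \<in> e <# S"
      using ab c mult_mem by (auto simp: l_coset_def)
    ultimately show ?thesis by blast
  qed
  then have "(\<lambda>a. gcls a e) ` (e <# S) = carrier (grothendieck (G\<lparr>carrier := S\<rparr>))"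
    using KS e gcls_mem gcls_cases by (auto; metis)
  ultimately show ?thesis
    by (auto simp: iso_def bij_betw_def)
qed

end

context comm_monoid
begin

lemma comm_subsemigroup_carrier: "comm_subsemigroup G (carrier G)"
  by unfold_locales (auto simp: subsemigroup_def)

lemma comm_subsemigroup_archi_class:
  "x \<in> carrier G \<Longrightarrow> comm_subsemigroup G (archi_class G x)"
  by unfold_locales (rule subsemigroup_archi_class)

text \<open>The units of any monoid form a group, and the local monoid is a monoid because its
  elements are exactly those that absorb \<open>e\<close>.\<close>

lemma group_archi_group:
  assumes e: "e \<in> idempotents G"
  shows "group (archi_group G e)"
proof -
  have ee: "e \<in> carrier G" "e \<otimes> e = e"
    using idempotentsD[OF e] .
  have local: "x \<in> carrier (local_monoid G e) \<longleftrightarrow> x \<in> carrier G \<and> e \<otimes> x = x" for x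
    using ee by (auto simp: local_monoid_def l_coset_def m_assoc[symmetric]) metis
  have "monoid (local_monoid G e)"
    by (rule monoidI; use ee in \<open>simp add: local; simp add: local_monoid_def m_ac\<close>)
      (metis m_assoc m_comm)
  then have "group (units_of (local_monoid G e))"
    by (rule monoid.units_group)
  then show ?thesis
    by (simp add: archi_group_eq_units[OF e])
qed

lemma grothendieck_iso_archi_group:
  assumes e: "e \<in> idempotents G"
  shows "grothendieck (archi_semigroup G e) \<cong> archi_group G e"
proof -
  interpret S: comm_subsemigroup G "archi_class G e"
    using comm_subsemigroup_archi_class idempotentsD(1)[OF e] .
  have "(\<lambda>a. S.gcls a e) \<in> iso (archi_group G e) (grothendieck (archi_semigroup G e))"
    unfolding archi_group_def archi_semigroup_def
    using idempotentsD[OF e] idem_mem_archi_class[OF e] archi_class_cofactor[OF e]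
    by (intro S.groth_iso) metis+
  then show ?thesis
    using group.iso_sym group_archi_group[OF e] unfolding is_iso_def by blast
qed

end

section \<open>Finite commutative monoids: idempotent powers and the largest idempotent\<close>

locale finite_comm_monoid = comm_monoid G for G (structure) +
  assumes finite_carrier: "finite (carrier G)"
begin

text \<open>By the pigeonhole principle two powers of \<open>x\<close> agree, so the powers have
  period \<open>p\<close> from exponent \<open>i\<close> on. An exponent beyond \<open>i\<close>
  that is a multiple of \<open>p\<close> can be doubled without changing the power.\<close>

lemma idem_pow_exists:
  assumes x: "x \<in> carrier G"
  shows "\<exists>n::nat. n > 0 \<and> x [^] n \<in> idempotents G"
proof -
  have "\<not> inj (\<lambda>n::nat. x [^] n)"
    using x finite_carrier by (metis finite_imageD finite_subset image_subsetI infinite_UNIV_nat nat_pow_closed)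
  then obtain i j :: nat where ij: "i < j" "x [^] i = x [^] j"
    unfolding inj_def by (metis linorder_neqE_nat)
  define p where "p = j - i"
  have p: "p > 0" "x [^] (i + p) = x [^] i"
    using ij by (auto simp: p_def)
  have step: "x [^] (i + m + p * k) = x [^] (i + m)" for m k :: nat
  proof (induction k)
    case (Suc k)
    have "x [^] (i + m + p * Suc k) = x [^] (i + p) \<otimes> x [^] (m + p * k)"
      using x by (simp add: nat_pow_mult algebra_simps)
    also have "\<dots> = x [^] (i + m + p * k)"
      using x by (simp add: p(2) nat_pow_mult algebra_simps)
    finally show ?case using Suc by simp
  qed simp
  \<comment> \<open>A multiple of the period that is at least \<open>i\<close>; \<open>Suc\<close>
    keeps it positive when \<open>i = 0\<close>.\<close>
  define n where "n = p * Suc i"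
  have "n \<ge> i" "n > 0" using p mult_le_mono[of 1 p i "Suc i"] by (auto simp: n_def)
  then have "x [^] n \<otimes> x [^] n = x [^] n"
    using step[of "n - i" "Suc i"] x by (simp add: n_def nat_pow_mult)
  then show ?thesis
    using x \<open>n > 0\<close> by (auto simp: idempotents_def)
qed

lemma archi_idem_exists:
  assumes x: "x \<in> carrier G"
  obtains e where "e \<in> idempotents G" "archi_equiv G e x"
proof -
  obtain n :: nat where n: "n > 0" "x [^] n \<in> idempotents G"
    using idem_pow_exists[OF x] by auto
  then obtain k where k: "n = Suc k" by (cases n) auto
  have "(x [^] n) divides (x [^] n)"
    using x by auto
  moreover have "x divides ((x [^] n) [^] (1::nat))"
    using x k m_comm by (intro dividesI[of "x [^] k"]) auto
  ultimately have "archi_equiv G (x [^] n) x"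
    unfolding archi_equiv_def by blast
  with n that show ?thesis by blast
qed

lemma archi_class_unique_idem:
  assumes x: "x \<in> carrier G"
  shows "\<exists>!e. e \<in> archi_class G x \<and> e \<in> idempotents G"
proof -
  obtain e where e: "e \<in> idempotents G" "archi_equiv G e x"
    using archi_idem_exists[OF x] .
  have "f = e" if "f \<in> idempotents G" "archi_equiv G f x" for f
    using that e x idempotentsD archi_equiv_idem_eq archi_equiv_trans archi_equiv_sym by metis
  then show ?thesis
    using e idempotentsD by (auto simp: archi_class_def)
qed

lemma archi_class_partition:
  "carrier G = (\<Union>x\<in>idempotents G. archi_class G x)"
  "disjoint_family_on (archi_class G) (idempotents G)"
proof -
  show "carrier G = (\<Union>x\<in>idempotents G. archi_class G x)"
  proof (intro equalityI subsetI)
    fix x assume x: "x \<in> carrier G"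
    then obtain e where "e \<in> idempotents G" "archi_equiv G e x"
      by (rule archi_idem_exists)
    then show "x \<in> (\<Union>x\<in>idempotents G. archi_class G x)"
      using x by (auto simp: archi_class_def intro!: bexI[of _ e] archi_equiv_sym)
  qed (auto simp: archi_class_def)
  show "disjoint_family_on (archi_class G) (idempotents G)"
  unfolding disjoint_family_on_def
  proof (intro ballI impI equals0I)
    fix e f x assume ef: "e \<in> idempotents G" "f \<in> idempotents G" "e \<noteq> f"
      and "x \<in> archi_class G e \<inter> archi_class G f"
    then have "archi_equiv G e x" "archi_equiv G x f" "x \<in> carrier G"
      by (auto simp: archi_class_def archi_equiv_sym)
    then show False
      using ef archi_equiv_trans archi_equiv_idem_eq idempotentsD(1) by metis
  qed
qed

abbreviation "M \<equiv> e_max G"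

text \<open>Doubling can be done factor by factor, which makes \<open>M\<close> idempotent. An
  element lies below the idempotent of its own class, and that idempotent is one of the factors of
  \<open>M\<close>.\<close>

lemma e_max_idem: "M \<in> idempotents G"
  and divides_e_max: "\<And>x. x \<in> carrier G \<Longrightarrow> x divides M"
proof -
  have fin: "finite (idempotents G)"
    using finite_carrier by (auto simp: idempotents_def)
  have id: "(\<lambda>x. x) \<in> idempotents G \<rightarrow> carrier G"
    by (auto simp: idempotents_def)
  have "M \<otimes> M = (\<Otimes>x\<in>idempotents G. x \<otimes> x)"
    unfolding e_max_def using id by (subst finprod_multf) auto
  also have "\<dots> = M"
    unfolding e_max_def using id by (intro finprod_cong) (auto simp: idempotents_def simp_implies_def)
  finally show M: "M \<in> idempotents G"
    using id by (auto simp: idempotents_def e_max_def)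
  fix x assume x: "x \<in> carrier G"
  obtain e where e: "e \<in> idempotents G" "archi_equiv G e x"
    using archi_idem_exists[OF x] .
  have ec: "e \<in> carrier G" using idempotentsD[OF e(1)] by simp
  obtain n :: nat where "x divides (e [^] n)"
    using e(2) by (auto simp: archi_equiv_def)
  then have "x divides e"
    using divides_idem_pow e x by blast
  moreover have "M = e \<otimes> finprod G (\<lambda>x. x) (idempotents G - {e})"
  proof -
    have "finprod G (\<lambda>x. x) (insert e (idempotents G - {e})) =
        e \<otimes> finprod G (\<lambda>x. x) (idempotents G - {e})"
      using fin id ec by (intro finprod_insert) auto
    then show ?thesis using e by (simp add: e_max_def insert_absorb)
  qed
  then have "e divides M"
    using id by (intro dividesI[of "finprod G (\<lambda>x. x) (idempotents G - {e})"]) (auto intro!: finprod_closed)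
  ultimately show "x divides M"
    using divides_trans x ec by blast
qed

end

section \<open>The smallest ideal as the Grothendieck group\<close>

context comm_monoid
begin

text \<open>If \<open>e = x \<otimes> c\<close> then
  \<open>e \<otimes> y = x \<otimes> (c \<otimes> y)\<close>, so the ideal of an element above
  everything lies in every principal ideal.\<close>

lemma smallest_ideal_eq:
  assumes e: "e \<in> idempotents G" and max: "\<And>x. x \<in> carrier G \<Longrightarrow> x divides e"
  shows "smallest_ideal G = e <# carrier G"
proof
  show "smallest_ideal G \<subseteq> e <# carrier G"
    using idempotentsD(1)[OF e] by (auto simp: smallest_ideal_def)
  show "e <# carrier G \<subseteq> smallest_ideal G"
  proof (clarsimp simp: smallest_ideal_def l_coset_def)
    fix x y assume xy: "x \<in> carrier G" "y \<in> carrier G"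
    obtain c where "c \<in> carrier G" "e = x \<otimes> c"
      using max[OF xy(1)] by (auto simp: factor_def)
    then show "\<exists>h\<in>carrier G. e \<otimes> y = x \<otimes> h"
      using xy by (intro bexI[of _ "c \<otimes> y"]) (auto simp: m_assoc)
  qed
qed

text \<open>An \<open>a\<close> in the smallest ideal absorbs \<open>e\<close>, so its formal
  differences with \<open>e\<close> and with the identity coincide. This reduces the canonical map
  to the isomorphism for subsemigroups.\<close>

lemma groth_of_iso:
  assumes e: "e \<in> idempotents G" and max: "\<And>x. x \<in> carrier G \<Longrightarrow> x divides e"
  shows "groth_of G \<in> iso (recurrent_group G) (grothendieck G)"
proof -
  interpret S: comm_subsemigroup G "carrier G"
    by (rule comm_subsemigroup_carrier)
  have ee: "e \<in> carrier G" "e \<otimes> e = e"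
    using idempotentsD[OF e] .
  have "(\<lambda>a. S.gcls a e) \<in> iso \<lparr>carrier = e <# carrier G, monoid.mult = monoid.mult G, one = e\<rparr>
           (grothendieck (G\<lparr>carrier := carrier G\<rparr>))"
    using max ee by (intro S.groth_iso) (auto simp: factor_def)
  moreover have "S.gcls a e = groth_of G a" if "a \<in> e <# carrier G" for a
  proof -
    have "a \<in> carrier G" "e \<otimes> a = a"
      using that ee by (auto simp: l_coset_def m_assoc[symmetric])
    then have "S.gcls a e = S.gcls a \<one>"
      using ee by (subst S.gcls_eq_iff) auto
    then show ?thesis by (simp add: groth_of_def S.gcls_def)
  qed
  moreover have "a \<otimes> b \<in> e <# carrier G" if "a \<in> e <# carrier G" "b \<in> e <# carrier G" for a b
    using that ee by (auto simp: l_coset_def m_assoc)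
  ultimately show ?thesis
    by (simp add: recurrent_group_def smallest_ideal_eq[OF assms] iso_def hom_def bij_betw_def
        inj_on_def Pi_def ee)
qed

end

section \<open>Direct limits\<close>

text \<open>By \<open>compat\<close> and \<open>eventually_eq\<close> the maps \<psi> identify
  exactly the elements that become equal at some later index. So the classes of the direct limit are
  the fibres of the joint map \<Psi>, and the limit is \<open>L\<close> with each point replaced by
  its fibre.\<close>

lemma is_dirlimI:
  assumes directed: "\<And>i j. i \<in> I \<Longrightarrow> j \<in> I \<Longrightarrow> \<exists>k\<in>I. leq i k \<and> leq j k"
    and mult_closed: "\<And>i a b. i \<in> I \<Longrightarrow> a \<in> carrier (G i) \<Longrightarrow> b \<in> carrier (G i)
      \<Longrightarrow> a \<otimes>\<^bsub>G i\<^esub> b \<in> carrier (G i)"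
    and \<phi>_closed: "\<And>i j a. i \<in> I \<Longrightarrow> j \<in> I \<Longrightarrow> leq i j \<Longrightarrow> a \<in> carrier (G i)
      \<Longrightarrow> \<phi> i j a \<in> carrier (G j)"
    and \<psi>_closed: "\<And>i a. i \<in> I \<Longrightarrow> a \<in> carrier (G i) \<Longrightarrow> \<psi> i a \<in> carrier L"
    and \<psi>_mult: "\<And>i a b. i \<in> I \<Longrightarrow> a \<in> carrier (G i) \<Longrightarrow> b \<in> carrier (G i)
      \<Longrightarrow> \<psi> i (a \<otimes>\<^bsub>G i\<^esub> b) = \<psi> i a \<otimes>\<^bsub>L\<^esub> \<psi> i b"
    and compat: "\<And>i j a. i \<in> I \<Longrightarrow> j \<in> I \<Longrightarrow> leq i j \<Longrightarrow> a \<in> carrier (G i)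
      \<Longrightarrow> \<psi> j (\<phi> i j a) = \<psi> i a"
    and eventually_eq: "\<And>i j a b. i \<in> I \<Longrightarrow> j \<in> I \<Longrightarrow> a \<in> carrier (G i) \<Longrightarrow> b \<in> carrier (G j)
      \<Longrightarrow> \<psi> i a = \<psi> j b \<Longrightarrow> \<exists>k\<in>I. leq i k \<and> leq j k \<and> \<phi> i k a = \<phi> j k b"
    and surj: "\<And>l. l \<in> carrier L \<Longrightarrow> \<exists>i\<in>I. \<exists>a\<in>carrier (G i). \<psi> i a = l"
  shows "is_dirlim I leq G \<phi> L \<psi>"
proof -
  define R where "R = dirlim_rel I leq G \<phi>"
  define \<Psi> where "\<Psi> = (\<lambda>(i, a). \<psi> i a)"
  define fiber where "fiber l = {p \<in> (SIGMA i:I. carrier (G i)). \<Psi> p = l}" for l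
  have R_iff: "((i, a), (j, b)) \<in> R \<longleftrightarrow>
      i \<in> I \<and> j \<in> I \<and> a \<in> carrier (G i) \<and> b \<in> carrier (G j) \<and> \<psi> i a = \<psi> j b" for i a j b
    unfolding R_def dirlim_rel_def using eventually_eq compat by auto metis
  have R_fiber: "R `` {(i, a)} = fiber (\<psi> i a)" if "i \<in> I" "a \<in> carrier (G i)" for i a
    using that by (auto simp: fiber_def R_iff \<Psi>_def)
  have fiber_nonempty: "fiber l \<noteq> {}" if l: "l \<in> carrier L" for l
  proof -
    obtain i a where "i \<in> I" "a \<in> carrier (G i)" "\<psi> i a = l"
      using surj[OF l] by auto
    then have "(i, a) \<in> fiber l" by (auto simp: fiber_def \<Psi>_def)
    then show ?thesis by blast
  qed
  have image_fiber: "\<Psi> ` fiber l = {l}" if "l \<in> carrier L" for l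
    using fiber_nonempty[OF that] by (auto simp: fiber_def)
  define h where "h A = the_elem (\<Psi> ` A)" for A
  have h: "h (fiber l) = l" if "l \<in> carrier L" for l
    using image_fiber[OF that] by (simp add: h_def)
  have carrier: "carrier (dirlim I leq G \<phi>) = fiber ` carrier L"
  proof -
    have "fiber l \<in> (SIGMA i:I. carrier (G i)) // R" if l: "l \<in> carrier L" for l
      using surj[OF l] R_fiber by (auto intro!: quotientI simp: quotient_def)
    moreover have "A \<in> fiber ` carrier L" if "A \<in> (SIGMA i:I. carrier (G i)) // R" for A
      using that R_fiber \<psi>_closed by (auto simp: quotient_def)
    ultimately show ?thesis
      by (auto simp: dirlim_def R_def[symmetric])
  qed
  have mult: "fiber l \<otimes>\<^bsub>dirlim I leq G \<phi>\<^esub> fiber m = fiber (l \<otimes>\<^bsub>L\<^esub> m)"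
    if l: "l \<in> carrier L" and m: "m \<in> carrier L" for l m
  proof -
    have *: "R `` {(k, \<phi> i k a \<otimes>\<^bsub>G k\<^esub> \<phi> j k b)} = fiber (l \<otimes>\<^bsub>L\<^esub> m)"
      if "(i, a) \<in> fiber l" "(j, b) \<in> fiber m" "k \<in> {k \<in> I. leq i k \<and> leq j k}" for i j k a b
      using that R_fiber mult_closed \<phi>_closed \<psi>_mult compat by (auto simp: fiber_def \<Psi>_def)
    \<comment> \<open>Directedness keeps the union over the common upper bounds nonempty; an empty
      union would destroy the product.\<close>
    have dir: "{k \<in> I. leq i k \<and> leq j k} \<noteq> {}"
      if "(i, a) \<in> fiber l" "(j, b) \<in> fiber m" for i j a b
      using that directed by (auto simp: fiber_def)
    have "fiber l \<otimes>\<^bsub>dirlim I leq G \<phi>\<^esub> fiber m =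
        (\<Union>(i, a)\<in>fiber l. \<Union>(j, b)\<in>fiber m. \<Union>k\<in>{k \<in> I. leq i k \<and> leq j k}.
          R `` {(k, \<phi> i k a \<otimes>\<^bsub>G k\<^esub> \<phi> j k b)})"
      by (simp add: dirlim_def R_def)
    also have "\<dots> = (\<Union>p\<in>fiber l. \<Union>q\<in>fiber m. fiber (l \<otimes>\<^bsub>L\<^esub> m))"
    proof (rule SUP_cong[OF HOL.refl], goal_cases)
      case (1 p)
      obtain i a where p: "p = (i, a)" by fastforce
      show ?case
        unfolding p prod.case
      proof (rule SUP_cong[OF HOL.refl], goal_cases)
        case (1 q)
        obtain j b where q: "q = (j, b)" by fastforce
        have "(\<Union>k\<in>{k \<in> I. leq i k \<and> leq j k}. R `` {(k, \<phi> i k a \<otimes>\<^bsub>G k\<^esub> \<phi> j k b)}) =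
            (\<Union>k\<in>{k \<in> I. leq i k \<and> leq j k}. fiber (l \<otimes>\<^bsub>L\<^esub> m))"
          using * \<open>p \<in> fiber l\<close> 1 unfolding p q by (intro SUP_cong HOL.refl) blast
        also have "\<dots> = fiber (l \<otimes>\<^bsub>L\<^esub> m)"
          using dir \<open>p \<in> fiber l\<close> 1 unfolding p q by (simp only: UN_constant if_False)
        finally show ?case
          unfolding q by simp
      qed
    qed
    also have "\<dots> = fiber (l \<otimes>\<^bsub>L\<^esub> m)"
      using fiber_nonempty[OF l] fiber_nonempty[OF m] by simp
    finally show ?thesis .
  qed
  \<comment> \<open>Two elements of \<open>L\<close> are lifted to a common index and multiplied
    there.\<close>
  have L_closed: "l \<otimes>\<^bsub>L\<^esub> m \<in> carrier L" if l: "l \<in> carrier L" and m: "m \<in> carrier L" for l m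
  proof -
    obtain i a j b where ia: "i \<in> I" "a \<in> carrier (G i)" "\<psi> i a = l"
      and jb: "j \<in> I" "b \<in> carrier (G j)" "\<psi> j b = m"
      using surj[OF l] surj[OF m] by auto
    obtain k where "k \<in> I" "leq i k" "leq j k"
      using directed ia jb by blast
    then have "l \<otimes>\<^bsub>L\<^esub> m = \<psi> k (\<phi> i k a \<otimes>\<^bsub>G k\<^esub> \<phi> j k b)" "k \<in> I"
      "\<phi> i k a \<otimes>\<^bsub>G k\<^esub> \<phi> j k b \<in> carrier (G k)"
      using ia jb by (auto simp: \<psi>_mult compat \<phi>_closed mult_closed)
    then show ?thesis using \<psi>_closed by simp
  qed
  have "h \<in> iso (dirlim I leq G \<phi>) L"
    unfolding iso_def hom_def bij_betw_def inj_on_def carrier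
    using h mult L_closed by (auto simp: image_image)
  moreover have "h (dirlim_rel I leq G \<phi> `` {(i, a)}) = \<psi> i a" if "i \<in> I" "a \<in> carrier (G i)" for i a
    using that R_fiber[OF that] h \<psi>_closed by (simp add: R_def)
  ultimately show ?thesis
    unfolding is_dirlim_def by blast
qed

context finite_comm_monoid
begin

lemma grothendieck_dirlim:
  "is_dirlim (idempotents G) (\<lambda>e f. e divides f)
     (\<lambda>e. grothendieck (archi_semigroup G e))
     (\<lambda>e f. groth_map (archi_semigroup G f) (\<lambda>y. f \<otimes> y))
     (grothendieck G) (\<lambda>e. groth_map G (\<lambda>y. y))"
proof -
  define cls where "cls S = comm_subsemigroup.gcls G S" for S
  have sub: "comm_subsemigroup G (archi_class G e)" if "e \<in> idempotents G" for e
    using comm_subsemigroup_archi_class idempotentsD(1)[OF that] .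
  interpret C: comm_subsemigroup G "carrier G"
    by (rule comm_subsemigroup_carrier)
  have CG: "G\<lparr>carrier := carrier G\<rparr> = G" by simp
  have max_mem: "M \<otimes> x \<in> archi_class G M" if "x \<in> carrier G" for x
    using that idempotentsD[OF e_max_idem] divides_e_max
    by (intro absorbing_mem_archi_class e_max_idem) (auto simp: m_assoc[symmetric])
  \<comment> \<open>\<open>y\<close> divides \<open>e\<close> and hence \<open>f\<close>, so
    \<open>f \<otimes> y\<close> divides \<open>f \<otimes> f = f\<close>; it also absorbs
    \<open>f\<close>.\<close>
  have trans_mem: "f \<otimes> y \<in> archi_class G f"
    if ef: "e \<in> idempotents G" "f \<in> idempotents G" "e divides f" and y: "y \<in> archi_class G e" for e f y
  proof (rule absorbing_mem_archi_class[OF ef(2)])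
    have f: "f \<in> carrier G" "f \<otimes> f = f" using idempotentsD[OF ef(2)] .
    have yc: "y \<in> carrier G" "y divides e" using y ef by (auto simp: archi_class_idem_iff)
    then have "y divides f" using ef divides_trans by blast
    then obtain c where c: "c \<in> carrier G" "f = y \<otimes> c" by (auto simp: factor_def)
    then show "(f \<otimes> y) divides f"
      using f yc by (intro dividesI[of c]) (auto simp: m_assoc)
    show "f \<otimes> y \<in> carrier G" "f \<otimes> (f \<otimes> y) = f \<otimes> y"
      using f yc by (auto simp: m_assoc[symmetric])
  qed
  have \<phi>: "groth_map (archi_semigroup G f) (\<lambda>y. f \<otimes> y) (cls (archi_class G e) a b)
      = cls (archi_class G f) (f \<otimes> a) (f \<otimes> b)"
    if "e \<in> idempotents G" "f \<in> idempotents G" "e divides f"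
      "a \<in> archi_class G e" "b \<in> archi_class G e" for e f a b
  proof -
    interpret S: comm_subsemigroup G "archi_class G e" using sub that by blast
    have "f \<otimes> (x \<otimes> y) = f \<otimes> x \<otimes> (f \<otimes> y)" if "x \<in> archi_class G e" "y \<in> archi_class G e" for x y
    proof -
      have "f \<otimes> x \<otimes> (f \<otimes> y) = (f \<otimes> f) \<otimes> (x \<otimes> y)"
        using that S.mem_carrier idempotentsD(1)[OF \<open>f \<in> idempotents G\<close>] by (simp add: m_ac)
      then show ?thesis using idempotentsD(2)[OF \<open>f \<in> idempotents G\<close>] by simp
    qed
    then show ?thesis
      unfolding cls_def archi_semigroup_def
      using that trans_mem sub by (intro S.groth_map_gcls) auto
  qed
  have \<psi>: "groth_map G (\<lambda>y. y) (cls (archi_class G e) a b) = C.gcls a b"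
    if "e \<in> idempotents G" "a \<in> archi_class G e" "b \<in> archi_class G e" for e a b
  proof -
    interpret S: comm_subsemigroup G "archi_class G e" using sub that by blast
    show ?thesis
      using S.groth_map_gcls[OF comm_subsemigroup_carrier, of "\<lambda>y. y" a b] that S.mem_carrier
      by (simp add: cls_def)
  qed
  have cases: "\<exists>a b. a \<in> archi_class G e \<and> b \<in> archi_class G e \<and> A = cls (archi_class G e) a b"
    if "e \<in> idempotents G" "A \<in> carrier (grothendieck (archi_semigroup G e))" for e A
    using comm_subsemigroup.gcls_cases[OF sub[OF that(1)]] that(2)
    unfolding archi_semigroup_def cls_def by metis
  have cls_mem: "cls (archi_class G e) a b \<in> carrier (grothendieck (archi_semigroup G e))"
    if "e \<in> idempotents G" "a \<in> archi_class G e" "b \<in> archi_class G e" for e a b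
    unfolding archi_semigroup_def cls_def
    using comm_subsemigroup.gcls_mem[OF sub[OF that(1)]] that by blast
  have cls_mult: "cls (archi_class G e) a b \<otimes>\<^bsub>grothendieck (archi_semigroup G e)\<^esub>
      cls (archi_class G e) c d = cls (archi_class G e) (a \<otimes> c) (b \<otimes> d)"
    if "e \<in> idempotents G" "a \<in> archi_class G e" "b \<in> archi_class G e"
      "c \<in> archi_class G e" "d \<in> archi_class G e" for e a b c d
    unfolding archi_semigroup_def cls_def
    using comm_subsemigroup.gcls_mult[OF sub[OF that(1)]] that by blast
  have mem_mult: "a \<otimes> b \<in> archi_class G e"
    if "e \<in> idempotents G" "a \<in> archi_class G e" "b \<in> archi_class G e" for e a b
    using comm_subsemigroup.mult_mem[OF sub[OF that(1)]] that by blast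
  note mem_carrier = archi_class_carrier[THEN subsetD]
  note C_mem = C.gcls_mem[unfolded CG] and C_mult = C.gcls_mult[unfolded CG]
    and C_cases = C.gcls_cases[unfolded CG]
  have M: "M \<in> carrier G" "M \<otimes> M = M"
    using idempotentsD[OF e_max_idem] .
  show ?thesis
  proof (rule is_dirlimI, goal_cases)
    case (1 e f)
    then show ?case
      using e_max_idem divides_e_max idempotentsD(1) by (intro bexI[of _ M]) auto
  next
    case (2 e A B)
    then obtain a b c d where "A = cls (archi_class G e) a b" "B = cls (archi_class G e) c d"
      "a \<in> archi_class G e" "b \<in> archi_class G e" "c \<in> archi_class G e" "d \<in> archi_class G e"
      using cases by metis
    then show ?case using 2 by (simp add: cls_mult cls_mem mem_mult)
  next
    case (3 e f A)
    then obtain a b where "A = cls (archi_class G e) a b"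
      "a \<in> archi_class G e" "b \<in> archi_class G e"
      using cases by metis
    then show ?case using 3 \<phi>[of e f a b] trans_mem[of e f] cls_mem by simp
  next
    case (4 e A)
    then obtain a b where "A = cls (archi_class G e) a b"
      "a \<in> archi_class G e" "b \<in> archi_class G e"
      using cases by metis
    then show ?case using 4 mem_carrier by (simp add: \<psi> C_mem)
  next
    case (5 e A B)
    then obtain a b c d where "A = cls (archi_class G e) a b" "B = cls (archi_class G e) c d"
      "a \<in> archi_class G e" "b \<in> archi_class G e" "c \<in> archi_class G e" "d \<in> archi_class G e"
      using cases by metis
    then show ?case using 5 mem_carrier by (simp add: cls_mult \<psi> mem_mult C_mult)
  next
    case (6 e f A)
    then obtain a b where A: "A = cls (archi_class G e) a b"
      and ab: "a \<in> archi_class G e" "b \<in> archi_class G e"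
      using cases by metis
    have f: "f \<in> carrier G" using 6 idempotentsD by blast
    \<comment> \<open>\<open>f\<close> occurs in both entries of the formal difference and cancels:
      transition maps are invisible in the group of the whole monoid.\<close>
    have "C.gcls (f \<otimes> a) (f \<otimes> b) = C.gcls a b"
      using f ab mem_carrier by (subst C.gcls_eq_iff) (auto simp: m_ac intro!: bexI[of _ \<one>])
    then show ?case
      using 6 A ab trans_mem[of e f] by (simp add: \<phi> \<psi>)
  next
    case (7 e f A B)
    then obtain a b c d where A: "A = cls (archi_class G e) a b" and B: "B = cls (archi_class G f) c d"
      and ab: "a \<in> archi_class G e" "b \<in> archi_class G e"
      and cd: "c \<in> archi_class G f" "d \<in> archi_class G f"
      using cases by metis
    then have "C.gcls a b = C.gcls c d"
      using 7 by (simp add: \<psi>)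
    then obtain x where x: "x \<in> carrier G" "a \<otimes> d \<otimes> x = b \<otimes> c \<otimes> x"
      using ab cd mem_carrier C.gcls_eq_iff by metis
    have carr: "a \<in> carrier G" "b \<in> carrier G" "c \<in> carrier G" "d \<in> carrier G"
      using ab cd mem_carrier by auto
    \<comment> \<open>The witness \<open>x\<close> may lie anywhere in the monoid. Multiplying every
      term by \<open>M\<close> moves the whole equation into the class of \<open>M\<close>.\<close>
    have "M \<otimes> a \<otimes> (M \<otimes> d) \<otimes> (M \<otimes> x) = M \<otimes> M \<otimes> M \<otimes> (a \<otimes> d \<otimes> x)"
      using carr x(1) M(1) by (simp add: m_ac)
    also have "\<dots> = M \<otimes> b \<otimes> (M \<otimes> c) \<otimes> (M \<otimes> x)"
      unfolding x(2) using carr x(1) M(1) by (simp add: m_ac)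
    finally have "cls (archi_class G M) (M \<otimes> a) (M \<otimes> b) = cls (archi_class G M) (M \<otimes> c) (M \<otimes> d)"
      unfolding cls_def using max_mem carr x(1)
      by (subst comm_subsemigroup.gcls_eq_iff[OF sub[OF e_max_idem]]) auto
    then have "groth_map (archi_semigroup G M) (\<lambda>y. M \<otimes> y) A =
        groth_map (archi_semigroup G M) (\<lambda>y. M \<otimes> y) B"
      using 7 ab cd e_max_idem divides_e_max idempotentsD(1) by (simp add: A B \<phi>)
    then show ?case
      using 7 e_max_idem divides_e_max idempotentsD(1) by (intro bexI[of _ M]) auto
  next
    case (8 l)
    then obtain a b where ab: "a \<in> carrier G" "b \<in> carrier G" "l = C.gcls a b"
      using C_cases by blast
    then have "l = C.gcls (M \<otimes> a) (M \<otimes> b)"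
      using M by (auto simp: C.gcls_eq_iff m_ac intro!: bexI[of _ \<one>])
    then have "groth_map G (\<lambda>y. y) (cls (archi_class G M) (M \<otimes> a) (M \<otimes> b)) = l"
      using \<psi>[OF e_max_idem] max_mem ab by simp
    then show ?case
      using cls_mem[OF e_max_idem] max_mem ab e_max_idem by blast
  qed
qed

lemma grothendieck_iso_archi_group_e_max: "grothendieck G \<cong> archi_group G M"
proof -
  have M: "M \<in> carrier G" "M \<otimes> M = M"
    using idempotentsD[OF e_max_idem] .
  have "smallest_ideal G = M <# carrier G"
    by (intro smallest_ideal_eq e_max_idem divides_e_max)
  moreover have "M <# archi_class G M = M <# carrier G"
  proof (intro equalityI subsetI)
    fix x assume "x \<in> M <# carrier G"
    then obtain y where y: "y \<in> carrier G" "x = M \<otimes> y"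
      by (auto simp: l_coset_def)
    then have x: "x \<in> carrier G" "M \<otimes> x = x"
      using M by (auto simp: m_assoc[symmetric])
    have "x \<in> archi_class G M"
      by (intro absorbing_mem_archi_class e_max_idem divides_e_max x)
    then show "x \<in> M <# archi_class G M"
      using x(2) unfolding l_coset_def by force
  qed (auto simp: l_coset_def archi_class_def)
  \<comment> \<open>The two records agree in carrier and multiplication, which is all that
    \<open>iso\<close> looks at.\<close>
  ultimately have "iso (recurrent_group G) (grothendieck G) = iso (archi_group G M) (grothendieck G)"
    by (simp add: iso_def hom_def recurrent_group_def archi_group_def)
  moreover have "groth_of G \<in> iso (recurrent_group G) (grothendieck G)"
    by (rule groth_of_iso[OF e_max_idem]) (rule divides_e_max)
  ultimately have "archi_group G M \<cong> grothendieck G"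
    unfolding is_iso_def by blast
  then show ?thesis
    using group.iso_sym group_archi_group[OF e_max_idem] by blast
qed

end

section \<open>Chip-firing\<close>

text \<open>Discarding a chip at the sink also counts as firing: the sink has no outgoing arcs, so
  \<open>max 1\<close> and the empty spill give exactly the relation \<open>s = 0\<close>.\<close>

definition chips :: "('v, 'e) pre_digraph \<Rightarrow> 'v \<Rightarrow> 'v multiset" where
  "chips E v = replicate_mset (max 1 (card (out_arcs E v))) v"

definition spill :: "('v, 'e) pre_digraph \<Rightarrow> 'v \<Rightarrow> 'v multiset" where
  "spill E v = image_mset (head E) (mset_set (out_arcs E v))"

definition fires :: "('v, 'e) pre_digraph \<Rightarrow> 'v multiset \<Rightarrow> 'v multiset \<Rightarrow> bool" where
  "fires E \<alpha> \<beta> \<longleftrightarrow> (\<exists>v\<in>verts E. \<exists>\<sigma>. \<alpha> = \<sigma> + chips E v \<and> \<beta> = \<sigma> + spill E v)"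

lemma firesI: "v \<in> verts E \<Longrightarrow> fires E (\<sigma> + chips E v) (\<sigma> + spill E v)"
  by (auto simp: fires_def)

lemma fires_add: "fires E \<alpha> \<beta> \<Longrightarrow> fires E (\<alpha> + \<gamma>) (\<beta> + \<gamma>)"
  unfolding fires_def by (metis (no_types, lifting) add.assoc add.commute)

lemma fires_rtranclp_add: "(fires E)\<^sup>*\<^sup>* \<alpha> \<beta> \<Longrightarrow> (fires E)\<^sup>*\<^sup>* (\<alpha> + \<gamma>) (\<beta> + \<gamma>)"
  by (induction rule: rtranclp_induct) (auto intro: rtranclp.rtrancl_into_rtrancl fires_add)

text \<open>Chips at distinct vertices do not interfere, so two different firings commute.\<close>

lemma strong_confluentp_fires: "strong_confluentp (fires E)"
proof (rule strong_confluentpI)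
  fix \<alpha> \<beta> \<gamma> assume "fires E \<alpha> \<beta>" "fires E \<alpha> \<gamma>"
  then obtain v w \<sigma> \<tau> where v: "v \<in> verts E" "\<alpha> = \<sigma> + chips E v" "\<beta> = \<sigma> + spill E v"
    and w: "w \<in> verts E" "\<alpha> = \<tau> + chips E w" "\<gamma> = \<tau> + spill E w"
    unfolding fires_def by blast
  show "\<exists>\<delta>. (fires E)\<^sup>*\<^sup>* \<beta> \<delta> \<and> (fires E)\<^sup>=\<^sup>= \<gamma> \<delta>"
  proof (cases "v = w")
    case True
    then have "\<beta> = \<gamma>" using v w by simp
    then show ?thesis by blast
  next
    case False
    have "chips E w \<subseteq># \<sigma>"
    proof (rule mset_subset_eqI)
      fix u
      have "count (\<sigma> + chips E v) u = count (\<tau> + chips E w) u"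
        using v(2) w(2) by simp
      then show "count (chips E w) u \<le> count \<sigma> u"
        using False by (auto simp: chips_def simp flip: count_greater_zero_iff split: if_splits)
    qed
    then obtain \<rho> where \<rho>: "\<sigma> = \<rho> + chips E w"
      by (metis subset_mset.diff_add)
    then have \<tau>: "\<tau> = \<rho> + chips E v"
      using v(2) w(2) by (simp add: union_ac)
    have "fires E \<beta> (\<rho> + spill E v + spill E w)"
      using firesI[OF w(1), of "\<rho> + spill E v"] v(3) \<rho> by (simp add: union_ac)
    moreover have "fires E \<gamma> (\<rho> + spill E v + spill E w)"
      using firesI[OF v(1), of "\<rho> + spill E w"] w(3) \<tau> by (simp add: union_ac)
    ultimately show ?thesis by blast
  qed
qed

lemma confluentp_fires: "confluentp (fires E)"
  by (intro strong_confluentp_imp_confluentp strong_confluentp_fires)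

context fin_digraph
begin

lemma chips_nonsink:
  assumes "v \<in> verts G" "\<not> is_sink G v"
  shows "chips G v = replicate_mset (card (out_arcs G v)) v"
proof -
  have "card (out_arcs G v) > 0"
    using assms by (auto simp: is_sink_def card_gt_0_iff)
  then show ?thesis by (simp add: chips_def max_def)
qed

lemma chips_sink: "is_sink G v \<Longrightarrow> chips G v = {#v#}"
  and spill_sink: "is_sink G v \<Longrightarrow> spill G v = {#}"
  by (auto simp: is_sink_def chips_def spill_def)

lemma chips_spill_cong: "v \<in> verts G \<Longrightarrow> (chips G v, spill G v) \<in> sp_cong G"
  using sp_cong.sink[of G v] sp_cong.topple[of v G] chips_sink[of v] spill_sink[of v]
  by (cases "is_sink G v") (simp_all add: chips_nonsink spill_def)

lemma set_mset_spill: "set_mset (spill G v) = head G ` out_arcs G v"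
  by (simp add: spill_def finite_out_arcs)

lemma set_mset_chips: "set_mset (chips G v) = {v}"
  by (simp add: chips_def)

lemma sp_cong_free: "(\<alpha>, \<beta>) \<in> sp_cong G \<Longrightarrow> \<alpha> \<in> free_elems G \<and> \<beta> \<in> free_elems G"
proof (induction rule: sp_cong.induct)
  case (topple v)
  then show ?case
    using set_mset_spill[of v] by (auto simp: free_elems_def spill_def split: if_splits)
qed (auto simp: free_elems_def is_sink_def)

lemma fires_cong:
  assumes "fires G \<alpha> \<beta>" "\<alpha> \<in> free_elems G"
  shows "(\<alpha>, \<beta>) \<in> sp_cong G"
proof -
  obtain v \<sigma> where v: "v \<in> verts G" "\<alpha> = \<sigma> + chips G v" "\<beta> = \<sigma> + spill G v"
    using assms(1) by (auto simp: fires_def)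
  then have "\<sigma> \<in> free_elems G"
    using assms(2) by (simp add: free_elems_def)
  then show ?thesis
    unfolding v by (intro sp_cong.add sp_cong.refl chips_spill_cong v(1))
qed

lemma rtranclp_fires_cong:
  assumes "(fires G)\<^sup>*\<^sup>* \<alpha> \<beta>" "\<alpha> \<in> free_elems G"
  shows "(\<alpha>, \<beta>) \<in> sp_cong G"
  using assms(1)
proof (induction rule: rtranclp_induct)
  case base
  show ?case using assms(2) by (rule sp_cong.refl)
next
  case (step \<beta> \<gamma>)
  then show ?case
    using sp_cong.trans fires_cong sp_cong_free by blast
qed

text \<open>The Church-Rosser property. Confluence enters at transitivity, where two descendants of
  the middle configuration have to be merged; for sums, one summand is run while the other
  rests.\<close>

lemma sp_cong_iff_joinable:
  "(\<alpha>, \<beta>) \<in> sp_cong G \<longleftrightarrow> \<alpha> \<in> free_elems G \<and> \<beta> \<in> free_elems G \<and>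
     (\<exists>\<gamma>. (fires G)\<^sup>*\<^sup>* \<alpha> \<gamma> \<and> (fires G)\<^sup>*\<^sup>* \<beta> \<gamma>)"
proof
  assume *: "(\<alpha>, \<beta>) \<in> sp_cong G"
  have "\<exists>\<gamma>. (fires G)\<^sup>*\<^sup>* \<alpha> \<gamma> \<and> (fires G)\<^sup>*\<^sup>* \<beta> \<gamma>"
    using *
  proof (induction rule: sp_cong.induct)
    case (sink s)
    then have "fires G {#s#} {#}"
      using firesI[of s G "{#}"] by (simp add: chips_sink spill_sink is_sink_def)
    then show ?case by blast
  next
    case (topple v)
    then have "fires G (chips G v) (spill G v)"
      using firesI[of v G "{#}"] by simp
    then show ?case
      using topple by (auto simp: chips_nonsink spill_def)
  next
    case (trans \<alpha> \<beta> \<gamma>)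
    then obtain \<delta> \<epsilon> where "(fires G)\<^sup>*\<^sup>* \<alpha> \<delta>" "(fires G)\<^sup>*\<^sup>* \<beta> \<delta>" "(fires G)\<^sup>*\<^sup>* \<beta> \<epsilon>" "(fires G)\<^sup>*\<^sup>* \<gamma> \<epsilon>"
      by blast
    moreover from this obtain \<zeta> where "(fires G)\<^sup>*\<^sup>* \<delta> \<zeta>" "(fires G)\<^sup>*\<^sup>* \<epsilon> \<zeta>"
      using confluentpD[OF confluentp_fires] by blast
    ultimately show ?case
      by (meson rtranclp_trans)
  next
    case (add \<alpha> \<beta> \<gamma> \<delta>)
    then obtain \<epsilon> \<zeta> where *: "(fires G)\<^sup>*\<^sup>* \<alpha> \<epsilon>" "(fires G)\<^sup>*\<^sup>* \<beta> \<epsilon>" "(fires G)\<^sup>*\<^sup>* \<gamma> \<zeta>" "(fires G)\<^sup>*\<^sup>* \<delta> \<zeta>"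
      by blast
    have sum: "(fires G)\<^sup>*\<^sup>* (\<mu> + \<nu>) (\<mu>' + \<nu>')"
      if "(fires G)\<^sup>*\<^sup>* \<mu> \<mu>'" "(fires G)\<^sup>*\<^sup>* \<nu> \<nu>'" for \<mu> \<mu>' \<nu> \<nu>'
      using fires_rtranclp_add[OF that(1), of \<nu>] fires_rtranclp_add[OF that(2), of \<mu>']
      by (metis add.commute rtranclp_trans)
    show ?case
      using sum * by blast
  qed blast+
  then show "\<alpha> \<in> free_elems G \<and> \<beta> \<in> free_elems G \<and>
      (\<exists>\<gamma>. (fires G)\<^sup>*\<^sup>* \<alpha> \<gamma> \<and> (fires G)\<^sup>*\<^sup>* \<beta> \<gamma>)"
    using sp_cong_free[OF *] by blast
next
  assume "\<alpha> \<in> free_elems G \<and> \<beta> \<in> free_elems G \<and>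
      (\<exists>\<gamma>. (fires G)\<^sup>*\<^sup>* \<alpha> \<gamma> \<and> (fires G)\<^sup>*\<^sup>* \<beta> \<gamma>)"
  then obtain \<gamma> where "(\<alpha>, \<gamma>) \<in> sp_cong G" "(\<beta>, \<gamma>) \<in> sp_cong G"
    using rtranclp_fires_cong by blast
  then show "(\<alpha>, \<beta>) \<in> sp_cong G"
    using sp_cong.trans[OF _ sp_cong.sym] by blast
qed

end

section \<open>The sandpile monoid\<close>

definition sp_class :: "('v, 'e) pre_digraph \<Rightarrow> 'v multiset \<Rightarrow> 'v multiset set" where
  "sp_class E \<alpha> = sp_cong E `` {\<alpha>}"

lemma free_elems_add [simp]:
  "\<alpha> + \<beta> \<in> free_elems E \<longleftrightarrow> \<alpha> \<in> free_elems E \<and> \<beta> \<in> free_elems E"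
  by (auto simp: free_elems_def)

lemma free_elems_empty [simp]: "{#} \<in> free_elems E"
  by (simp add: free_elems_def)

context fin_digraph
begin

lemma equiv_sp_cong: "equiv (free_elems G) (sp_cong G)"
proof (rule equivI)
  show "sp_cong G \<subseteq> free_elems G \<times> free_elems G"
    using sp_cong_free by auto
  show "refl_on (free_elems G) (sp_cong G)"
    by (auto simp: refl_on_def intro: sp_cong.refl)
  show "sym_on UNIV (sp_cong G)" by (auto simp: sym_on_def intro: sp_cong.sym)
  show "trans_on UNIV (sp_cong G)" by (auto simp: trans_on_def intro: sp_cong.trans)
qed

lemma sp_class_eq_iff:
  "\<alpha> \<in> free_elems G \<Longrightarrow> \<beta> \<in> free_elems G \<Longrightarrow>
    sp_class G \<alpha> = sp_class G \<beta> \<longleftrightarrow> (\<alpha>, \<beta>) \<in> sp_cong G"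
  unfolding sp_class_def by (rule eq_equiv_class_iff[OF equiv_sp_cong])

lemma mem_sp_class_iff: "\<beta> \<in> sp_class G \<alpha> \<longleftrightarrow> (\<alpha>, \<beta>) \<in> sp_cong G"
  by (simp add: sp_class_def)

lemma sp_class_of_mem:
  assumes "x \<in> carrier (SP G)" "\<alpha> \<in> x"
  shows "\<alpha> \<in> free_elems G" "x = sp_class G \<alpha>"
proof -
  obtain \<beta> where \<beta>: "\<beta> \<in> free_elems G" "x = sp_class G \<beta>"
    using assms(1) by (auto simp: SP_def sp_class_def elim: quotientE)
  then have "(\<beta>, \<alpha>) \<in> sp_cong G"
    using assms(2) by (simp add: mem_sp_class_iff)
  then show "\<alpha> \<in> free_elems G" "x = sp_class G \<alpha>"
    using \<beta> sp_cong_free sp_class_eq_iff by auto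
qed

lemma sp_class_carrier: "\<alpha> \<in> free_elems G \<Longrightarrow> sp_class G \<alpha> \<in> carrier (SP G)"
  by (simp add: SP_def sp_class_def quotientI)

lemma SP_cases:
  assumes "x \<in> carrier (SP G)"
  obtains \<alpha> where "\<alpha> \<in> free_elems G" "x = sp_class G \<alpha>"
  using assms by (auto simp: SP_def sp_class_def elim: quotientE)

lemma SP_one: "\<one>\<^bsub>SP G\<^esub> = sp_class G {#}"
  by (simp add: SP_def sp_class_def)

lemma SP_mult:
  assumes "\<alpha> \<in> free_elems G" "\<beta> \<in> free_elems G"
  shows "sp_class G \<alpha> \<otimes>\<^bsub>SP G\<^esub> sp_class G \<beta> = sp_class G (\<alpha> + \<beta>)"
proof -
  have "sp_class G (\<gamma> + \<delta>) = sp_class G (\<alpha> + \<beta>)"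
    if "\<gamma> \<in> sp_class G \<alpha>" "\<delta> \<in> sp_class G \<beta>" for \<gamma> \<delta>
  proof -
    have "(\<alpha> + \<beta>, \<gamma> + \<delta>) \<in> sp_cong G"
      using that sp_cong.add by (auto simp: mem_sp_class_iff)
    then show ?thesis
      using sp_class_eq_iff[of "\<alpha> + \<beta>" "\<gamma> + \<delta>"] sp_cong_free by blast
  qed
  then have "sp_class G \<alpha> \<otimes>\<^bsub>SP G\<^esub> sp_class G \<beta> =
      (\<Union>\<gamma>\<in>sp_class G \<alpha>. \<Union>\<delta>\<in>sp_class G \<beta>. sp_class G (\<alpha> + \<beta>))"
    by (simp add: SP_def sp_class_def)
  also have "\<dots> = sp_class G (\<alpha> + \<beta>)"
    using sp_cong.refl[OF assms(1)] sp_cong.refl[OF assms(2)] mem_sp_class_iff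
    by (metis UN_constant empty_iff)
  finally show ?thesis .
qed

lemma comm_monoid_SP: "comm_monoid (SP G)"
proof (rule comm_monoidI)
  fix x y z assume "x \<in> carrier (SP G)" "y \<in> carrier (SP G)" "z \<in> carrier (SP G)"
  then obtain \<alpha> \<beta> \<gamma> where *: "\<alpha> \<in> free_elems G" "x = sp_class G \<alpha>"
    "\<beta> \<in> free_elems G" "y = sp_class G \<beta>" "\<gamma> \<in> free_elems G" "z = sp_class G \<gamma>"
    by (metis SP_cases)
  then show "x \<otimes>\<^bsub>SP G\<^esub> y \<otimes>\<^bsub>SP G\<^esub> z = x \<otimes>\<^bsub>SP G\<^esub> (y \<otimes>\<^bsub>SP G\<^esub> z)"
    by (simp add: SP_mult union_ac)
next
  fix x y assume "x \<in> carrier (SP G)" "y \<in> carrier (SP G)"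
  then obtain \<alpha> \<beta> where *: "\<alpha> \<in> free_elems G" "x = sp_class G \<alpha>"
    "\<beta> \<in> free_elems G" "y = sp_class G \<beta>"
    by (metis SP_cases)
  show "x \<otimes>\<^bsub>SP G\<^esub> y = y \<otimes>\<^bsub>SP G\<^esub> x" "x \<otimes>\<^bsub>SP G\<^esub> y \<in> carrier (SP G)"
    using * by (simp_all add: SP_mult sp_class_carrier add.commute)
next
  fix x assume "x \<in> carrier (SP G)"
  then show "\<one>\<^bsub>SP G\<^esub> \<otimes>\<^bsub>SP G\<^esub> x = x"
    by (auto simp: SP_one SP_mult elim: SP_cases)
next
  show "\<one>\<^bsub>SP G\<^esub> \<in> carrier (SP G)"
    by (simp add: SP_one sp_class_carrier)
qed

lemma sp_class_divides_iff:
  assumes "\<alpha> \<in> free_elems G" "\<beta> \<in> free_elems G"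
  shows "sp_class G \<alpha> divides\<^bsub>SP G\<^esub> sp_class G \<beta> \<longleftrightarrow>
    (\<exists>\<gamma>\<in>free_elems G. (\<alpha> + \<gamma>, \<beta>) \<in> sp_cong G)"
proof
  assume "sp_class G \<alpha> divides\<^bsub>SP G\<^esub> sp_class G \<beta>"
  then obtain c where "c \<in> carrier (SP G)" "sp_class G \<beta> = sp_class G \<alpha> \<otimes>\<^bsub>SP G\<^esub> c"
    by (auto simp: factor_def)
  moreover from this obtain \<gamma> where "\<gamma> \<in> free_elems G" "c = sp_class G \<gamma>"
    by (auto elim: SP_cases)
  ultimately show "\<exists>\<gamma>\<in>free_elems G. (\<alpha> + \<gamma>, \<beta>) \<in> sp_cong G"
    using assms by (metis SP_mult free_elems_add sp_class_eq_iff)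
next
  assume "\<exists>\<gamma>\<in>free_elems G. (\<alpha> + \<gamma>, \<beta>) \<in> sp_cong G"
  then obtain \<gamma> where \<gamma>: "\<gamma> \<in> free_elems G" "(\<alpha> + \<gamma>, \<beta>) \<in> sp_cong G"
    by blast
  then have "sp_class G \<beta> = sp_class G \<alpha> \<otimes>\<^bsub>SP G\<^esub> sp_class G \<gamma>"
    using assms by (metis SP_mult free_elems_add sp_class_eq_iff)
  then show "sp_class G \<alpha> divides\<^bsub>SP G\<^esub> sp_class G \<beta>"
    using \<gamma> sp_class_carrier by (auto simp: factor_def)
qed

end

section \<open>Finiteness of the sandpile monoid\<close>

context sandpile_graph
begin

text \<open>Chips get heavier with the distance \<open>k\<close> from the sink, so concavely that the loss at the
  arc of the fired vertex that leads towards the sink outweighs the gains at all its other arcs.\<close>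

lemma decreasing_potential:
  "\<exists>w :: 'v \<Rightarrow> nat. \<forall>v\<in>verts E. (\<Sum>u\<in>#spill E v. w u) < (\<Sum>u\<in>#chips E v. w u)"
proof -
  obtain s where s: "is_sink E s" and s_unique: "\<And>t. is_sink E t \<Longrightarrow> t = s"
    using unique_sink by auto
  define dist where "dist v = (LEAST n. (v, s) \<in> arcs_ends E ^^ n)" for v
  define N where "N = Max (dist ` verts E)"
  define C where "C = Suc (card (arcs E))"
  \<comment> \<open>The final 1 gives a chip at the sink positive weight, so discarding it is a
    loss. With \<open>X = C ^ (N - dist v)\<close>, the arc towards the sink loses at least
    \<open>(C - 1) * X\<close>, every other arc of \<open>v\<close> gains at most
    \<open>X - 1\<close>, and \<open>C\<close> exceeds the out-degree of \<open>v\<close>.\<close>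
  define w where "w v = C ^ N - C ^ (N - dist v) + 1" for v
  have dist: "(v, s) \<in> arcs_ends E ^^ dist v" if "v \<in> verts E" for v
  proof -
    have "(v, s) \<in> (arcs_ends E)\<^sup>*"
      using reaches_sink[OF that s] by (rule reachable_rtranclI)
    then obtain n where "(v, s) \<in> arcs_ends E ^^ n"
      by (auto simp: rtrancl_power)
    then show ?thesis
      unfolding dist_def by (rule LeastI)
  qed
  have dist_le: "dist v \<le> N" if "v \<in> verts E" for v
    using that by (simp add: N_def)
  have C_pos: "C ^ n \<ge> 1" for n
    by (simp add: C_def)
  have C_mono: "C ^ m \<le> C ^ n" if "m \<le> n" for m n
    using that by (intro power_increasing) (auto simp: C_def)
  have w_le: "w v \<le> C ^ N" for v
    using C_pos[of "N - dist v"] C_pos[of N] by (simp add: w_def)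
  have "(\<Sum>u\<in>#spill E v. w u) < (\<Sum>u\<in>#chips E v. w u)" if v: "v \<in> verts E" for v
  proof (cases "is_sink E v")
    case True
    then show ?thesis by (simp add: chips_sink spill_sink w_def)
  next
    case False
    have "dist v \<noteq> 0"
      using dist[OF v] False s by (auto intro: ccontr)
    then obtain k where k: "dist v = Suc k"
      using not0_implies_Suc by blast
    then obtain u where u: "(v, u) \<in> arcs_ends E" "(u, s) \<in> arcs_ends E ^^ k"
      using dist[OF v] relpow_Suc_D2 by metis
    then obtain e where e: "e \<in> out_arcs E v" "head E e = u"
      by auto
    have "dist u \<le> k"
      unfolding dist_def using u(2) by (rule Least_le)
    then have w_u: "w u \<le> C ^ N - C ^ (N - k) + 1"
      using C_mono[of "N - k" "N - dist u"] by (simp add: w_def diff_le_mono2)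
    define X where "X = C ^ (N - dist v)"
    have "X > 0"
      unfolding X_def using C_pos[of "N - dist v"] by linarith
    have CX: "C ^ (N - k) = C * X"
      using dist_le[OF v] k by (simp add: X_def Suc_diff_Suc flip: power_Suc)
    \<comment> \<open>\<open>q\<close>, \<open>D\<close> and \<open>c\<close> below replace
      differences of natural numbers, so that the decisive inequality is polynomial.\<close>
    obtain q where q: "C ^ N = C * X + q"
      using C_mono[of "N - k" N] CX le_Suc_ex by auto
    obtain D where D: "card (out_arcs E v) = Suc D"
      using e(1) finite_out_arcs[of v] by (cases "card (out_arcs E v)") auto
    have "card (out_arcs E v) \<le> card (arcs E)"
      by (intro card_mono) auto
    then obtain c where c: "C = D + 2 + c"
      using D le_Suc_ex[of "D + 2" C] by (auto simp: C_def)
    have "(\<Sum>u\<in>#spill E v. w u) = (\<Sum>a\<in>out_arcs E v. w (head E a))"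
      by (simp add: spill_def sum_unfold_sum_mset image_mset.compositionality comp_def)
    also have "\<dots> = w u + (\<Sum>a\<in>out_arcs E v - {e}. w (head E a))"
      using e finite_out_arcs[of v] by (simp add: sum.remove)
    also have "\<dots> \<le> w u + card (out_arcs E v - {e}) * C ^ N"
      using sum_bounded_above[of "out_arcs E v - {e}" "\<lambda>a. w (head E a)" "C ^ N"] w_le by simp
    also have "\<dots> = w u + D * C ^ N"
      using e D finite_out_arcs[of v] by simp
    also have "\<dots> \<le> (q + 1) + D * (C * X + q)"
      using w_u CX q by simp
    also have "\<dots> < Suc D * ((D + 1 + c) * X + q + 1)"
      using \<open>X > 0\<close> by (simp add: c algebra_simps)
    also have "(D + 1 + c) * X + q + 1 = w v"
    proof -
      have "C * X + q - X = (D + 1 + c) * X + q"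
        by (simp add: c algebra_simps)
      then show ?thesis
        by (simp add: w_def X_def[symmetric] q)
    qed
    also have "Suc D * w v = (\<Sum>u\<in>#chips E v. w u)"
      using D by (simp add: chips_nonsink[OF v False])
    finally show ?thesis .
  qed
  then show ?thesis by blast
qed

lemma stabilization:
  assumes "\<alpha> \<in> free_elems E"
  shows "\<exists>\<beta>. (\<alpha>, \<beta>) \<in> sp_cong E \<and> (\<forall>\<gamma>. \<not> fires E \<beta> \<gamma>)"
proof -
  obtain w :: "'v \<Rightarrow> nat" where
    w: "\<And>v. v \<in> verts E \<Longrightarrow> (\<Sum>u\<in>#spill E v. w u) < (\<Sum>u\<in>#chips E v. w u)"
    using decreasing_potential by blast
  show ?thesis
    using assms
  proof (induction "\<Sum>u\<in>#\<alpha>. w u" arbitrary: \<alpha> rule: less_induct)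
    case less
    show ?case
    proof (cases "\<exists>\<gamma>. fires E \<alpha> \<gamma>")
      case True
      then obtain \<gamma> where \<gamma>: "fires E \<alpha> \<gamma>" by blast
      then have cong: "(\<alpha>, \<gamma>) \<in> sp_cong E"
        using fires_cong less.prems by blast
      have "(\<Sum>u\<in>#\<gamma>. w u) < (\<Sum>u\<in>#\<alpha>. w u)"
        using \<gamma> w by (auto simp: fires_def)
      then show ?thesis
        using less.hyps cong sp_cong_free sp_cong.trans by meson
    next
      case False
      then show ?thesis using less.prems sp_cong.refl by blast
    qed
  qed
qed

lemma finite_stable: "finite {\<beta> \<in> free_elems E. \<forall>\<gamma>. \<not> fires E \<beta> \<gamma>}"
proof (rule finite_subset)
  show "finite (\<Union>n\<le>card (verts E) * Suc (card (arcs E)). multisets_of_size (verts E) n)"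
    by (auto intro: finite_multisets_of_size)
  show "{\<beta> \<in> free_elems E. \<forall>\<gamma>. \<not> fires E \<beta> \<gamma>} \<subseteq>
      (\<Union>n\<le>card (verts E) * Suc (card (arcs E)). multisets_of_size (verts E) n)"
  proof clarify
    fix \<beta> assume \<beta>: "\<beta> \<in> free_elems E" "\<forall>\<gamma>. \<not> fires E \<beta> \<gamma>"
    \<comment> \<open>One bound for all vertices: it is at least the firing threshold
      \<open>max 1 (card (out_arcs E v))\<close>, also at the sink.\<close>
    have "count \<beta> v \<le> Suc (card (arcs E))" if v: "v \<in> verts E" for v
    proof (rule ccontr)
      assume *: "\<not> count \<beta> v \<le> Suc (card (arcs E))"
      have "card (out_arcs E v) \<le> card (arcs E)"
        by (intro card_mono) auto
      then have "chips E v \<subseteq># \<beta>"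
        using * by (auto simp: chips_def simp flip: count_le_replicate_mset_subset_eq count_greater_zero_iff)
      then obtain \<sigma> where "\<beta> = \<sigma> + chips E v"
        by (metis subset_mset.diff_add)
      then show False
        using \<beta>(2) firesI[OF v] by blast
    qed
    then have "(\<Sum>v\<in>set_mset \<beta>. count \<beta> v) \<le> card (set_mset \<beta>) * Suc (card (arcs E))"
      using \<beta>(1) sum_bounded_above[of "set_mset \<beta>" "count \<beta>" "Suc (card (arcs E))"]
      by (auto simp: free_elems_def)
    also have "\<dots> \<le> card (verts E) * Suc (card (arcs E))"
      using \<beta>(1) by (intro mult_right_mono card_mono) (auto simp: free_elems_def)
    finally have "size \<beta> \<le> card (verts E) * Suc (card (arcs E))"
      by (simp add: size_multiset_overloaded_eq)
    then show "\<beta> \<in> (\<Union>n\<le>card (verts E) * Suc (card (arcs E)). multisets_of_size (verts E) n)"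
      using \<beta>(1) by (auto simp: multisets_of_size_def free_elems_def)
  qed
qed

lemma finite_comm_monoid_SP: "finite_comm_monoid (SP E)"
proof -
  interpret comm_monoid "SP E" by (rule comm_monoid_SP)
  have "carrier (SP E) \<subseteq> sp_class E ` {\<beta> \<in> free_elems E. \<forall>\<gamma>. \<not> fires E \<beta> \<gamma>}"
  proof
    fix x assume "x \<in> carrier (SP E)"
    then obtain \<alpha> where \<alpha>: "\<alpha> \<in> free_elems E" "x = sp_class E \<alpha>"
      by (rule SP_cases)
    then obtain \<beta> where \<beta>: "(\<alpha>, \<beta>) \<in> sp_cong E" "\<forall>\<gamma>. \<not> fires E \<beta> \<gamma>"
      using stabilization by blast
    then have "\<beta> \<in> free_elems E" "x = sp_class E \<beta>"
      using \<alpha> sp_cong_free sp_class_eq_iff by auto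
    then show "x \<in> sp_class E ` {\<beta> \<in> free_elems E. \<forall>\<gamma>. \<not> fires E \<beta> \<gamma>}"
      using \<beta> by blast
  qed
  then show ?thesis
    using finite_stable by unfold_locales (meson finite_imageI finite_subset)
qed

end

section \<open>Restriction to hereditary saturated sets\<close>

context fin_digraph
begin

lemma out_arcs_restrict: "v \<in> H \<Longrightarrow> out_arcs (restrict_graph G H) v = out_arcs G v"
  by (auto simp: out_arcs_def restrict_graph_def)

lemma is_sink_restrict:
  "H \<subseteq> verts G \<Longrightarrow> is_sink (restrict_graph G H) v \<longleftrightarrow> v \<in> H \<and> is_sink G v"
  using out_arcs_restrict[of v H] by (auto simp: is_sink_def restrict_graph_def)

lemma free_elems_restrict: "free_elems (restrict_graph G H) = {\<alpha>. set_mset \<alpha> \<subseteq> H}"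
  by (simp add: free_elems_def restrict_graph_def)

lemma hereditary_fires_closed:
  assumes "hereditary G H" "fires G \<alpha> \<beta>" "set_mset \<alpha> \<subseteq> H"
  shows "set_mset \<beta> \<subseteq> H"
proof -
  obtain v \<sigma> where v: "\<alpha> = \<sigma> + chips G v" "\<beta> = \<sigma> + spill G v"
    using assms(2) by (auto simp: fires_def)
  \<comment> \<open>\<open>chips\<close> is never empty, so the fired vertex occurs in
    \<alpha>.\<close>
  then have "v \<in> H" "set_mset \<sigma> \<subseteq> H"
    using assms(3) by (auto simp: set_mset_chips)
  then show ?thesis
    using assms(1) v by (auto simp: set_mset_spill hereditary_def)
qed

lemma hereditary_rtranclp_fires_closed:
  assumes "(fires G)\<^sup>*\<^sup>* \<alpha> \<beta>" "hereditary G H" "set_mset \<alpha> \<subseteq> H"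
  shows "set_mset \<beta> \<subseteq> H"
  using assms by (induction rule: rtranclp_induct) (auto dest: hereditary_fires_closed)

text \<open>A configuration on \<open>H\<close> can fire only at vertices of \<open>H\<close>, and
  these keep all their outgoing arcs.\<close>

lemma fires_restrict_iff:
  assumes "hereditary G H" "set_mset \<alpha> \<subseteq> H"
  shows "fires (restrict_graph G H) \<alpha> \<beta> \<longleftrightarrow> fires G \<alpha> \<beta>"
proof -
  have *: "chips (restrict_graph G H) v = chips G v" "spill (restrict_graph G H) v = spill G v"
    if "v \<in> H" for v
    using that by (simp_all add: chips_def spill_def out_arcs_restrict) (simp add: restrict_graph_def)
  have verts: "verts (restrict_graph G H) = H" "H \<subseteq> verts G"
    using assms(1) by (auto simp: restrict_graph_def hereditary_def)
  have "v \<in> H" if "\<alpha> = \<sigma> + chips G v" for v \<sigma>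
    using that assms(2) by (auto simp: set_mset_chips)
  then show ?thesis
    using * verts unfolding fires_def by (metis subsetD)
qed

lemma rtranclp_fires_restrict_iff:
  assumes "hereditary G H" "set_mset \<alpha> \<subseteq> H"
  shows "(fires (restrict_graph G H))\<^sup>*\<^sup>* \<alpha> \<beta> \<longleftrightarrow> (fires G)\<^sup>*\<^sup>* \<alpha> \<beta>"
proof
  assume "(fires (restrict_graph G H))\<^sup>*\<^sup>* \<alpha> \<beta>"
  then have "(fires G)\<^sup>*\<^sup>* \<alpha> \<beta> \<and> set_mset \<beta> \<subseteq> H"
  proof (induction rule: rtranclp_induct)
    case (step \<beta> \<gamma>)
    then show ?case
      using fires_restrict_iff[OF assms(1)] hereditary_fires_closed[OF assms(1)]
      by (meson rtranclp.rtrancl_into_rtrancl)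
  qed (use assms in auto)
  then show "(fires G)\<^sup>*\<^sup>* \<alpha> \<beta>" ..
next
  assume "(fires G)\<^sup>*\<^sup>* \<alpha> \<beta>"
  then show "(fires (restrict_graph G H))\<^sup>*\<^sup>* \<alpha> \<beta>"
  proof (induction rule: rtranclp_induct)
    case (step \<beta> \<gamma>)
    then have "set_mset \<beta> \<subseteq> H"
      using hereditary_rtranclp_fires_closed assms by blast
    then show ?case
      using step fires_restrict_iff[OF assms(1)] by (meson rtranclp.rtrancl_into_rtrancl)
  qed auto
qed

lemma fin_digraph_restrict:
  assumes "hereditary G H"
  shows "fin_digraph (restrict_graph G H)"
proof
  show "finite (verts (restrict_graph G H))"
    using assms finite_subset[OF _ finite_verts] by (auto simp: restrict_graph_def hereditary_def)
  show "finite (arcs (restrict_graph G H))"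
    by (simp add: restrict_graph_def)
qed (use assms in \<open>auto simp: restrict_graph_def hereditary_def\<close>)

text \<open>The two runs to a common descendant start on \<open>H\<close>, never leave it, and are
  therefore runs of the restricted graph as well.\<close>

lemma sp_cong_restrict_iff:
  assumes "hereditary G H" "set_mset \<alpha> \<subseteq> H" "set_mset \<beta> \<subseteq> H"
  shows "(\<alpha>, \<beta>) \<in> sp_cong (restrict_graph G H) \<longleftrightarrow> (\<alpha>, \<beta>) \<in> sp_cong G"
proof -
  have "H \<subseteq> verts G"
    using assms(1) by (simp add: hereditary_def)
  then have "\<alpha> \<in> free_elems G" "\<beta> \<in> free_elems G"
    using assms by (auto simp: free_elems_def)
  then show ?thesis
    using assms by (simp add: sp_cong_iff_joinable rtranclp_fires_restrict_iff
        fin_digraph.sp_cong_iff_joinable[OF fin_digraph_restrict] free_elems_restrict)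
qed

text \<open>The whole vertex set thus takes part in the intersection that defines
  \<open>hs_closure\<close>, which keeps closures inside the graph.\<close>

lemma hereditary_verts: "hereditary G (verts G)"
  and saturated_verts: "saturated G (verts G)"
  by (auto simp: hereditary_def saturated_def is_regular_def)

lemma
  assumes "A \<subseteq> verts G"
  shows hereditary_hs_closure: "hereditary G (hs_closure G A)"
    and saturated_hs_closure: "saturated G (hs_closure G A)"
    and hs_closure_superset: "A \<subseteq> hs_closure G A"
proof -
  have sub: "hs_closure G A \<subseteq> verts G"
    unfolding hs_closure_def using assms hereditary_verts saturated_verts by blast
  show "hereditary G (hs_closure G A)"
    unfolding hereditary_def using sub by (auto simp: hs_closure_def hereditary_def)
  show "saturated G (hs_closure G A)"
    unfolding saturated_def
  proof (intro conjI sub allI impI)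
    fix v assume v: "is_regular G v \<and> head G ` out_arcs G v \<subseteq> hs_closure G A"
    have "v \<in> K" if "hereditary G K" "saturated G K" "A \<subseteq> K" for K
    proof -
      have "hs_closure G A \<subseteq> K"
        using that by (auto simp: hs_closure_def)
      then show ?thesis
        using v that(2) unfolding saturated_def by blast
    qed
    then show "v \<in> hs_closure G A"
      by (simp add: hs_closure_def)
  qed
  show "A \<subseteq> hs_closure G A"
    by (auto simp: hs_closure_def)
qed

lemma hs_closure_least:
  "hereditary G K \<Longrightarrow> saturated G K \<Longrightarrow> A \<subseteq> K \<Longrightarrow> hs_closure G A \<subseteq> K"
  by (auto simp: hs_closure_def)

end

section \<open>Hereditary and saturated sets in sandpile graphs\<close>

context sandpile_graph
begin

lemma hereditary_reachable:
  assumes "v \<rightarrow>\<^sup>*\<^bsub>E\<^esub> w" "hereditary E H" "v \<in> H"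
  shows "w \<in> H"
  using assms by (induction rule: reachable_induct) (auto simp: hereditary_def)

text \<open>A path to the sink that starts in \<open>H\<close> cannot leave
  \<open>H\<close>.\<close>

lemma sink_mem_hereditary:
  assumes "hereditary E H" "H \<noteq> {}" "is_sink E s"
  shows "s \<in> H"
  using assms reaches_sink hereditary_reachable unfolding hereditary_def by blast

lemma sandpile_graph_restrict:
  assumes H: "hereditary E H" "H \<noteq> {}"
  shows "sandpile_graph (restrict_graph E H)"
proof -
  interpret F: fin_digraph "restrict_graph E H"
    using H by (intro fin_digraph_restrict)
  have sub: "H \<subseteq> verts E"
    using H by (simp add: hereditary_def)
  have verts: "verts (restrict_graph E H) = H"
    by (simp add: restrict_graph_def)
  show ?thesis
  proof
    show "\<exists>!s. is_sink (restrict_graph E H) s"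
      unfolding is_sink_restrict[OF sub] using unique_sink sink_mem_hereditary[OF H] by blast
    fix v s assume v: "v \<in> verts (restrict_graph E H)" and s: "is_sink (restrict_graph E H) s"
    then have vH: "v \<in> H" and sE: "is_sink E s"
      using is_sink_restrict[OF sub] verts by auto
    have "v \<rightarrow>\<^sup>*\<^bsub>E\<^esub> s"
      using reaches_sink vH sE sub by blast
    then show "v \<rightarrow>\<^sup>*\<^bsub>restrict_graph E H\<^esub> s"
      using vH
    proof (induction rule: converse_reachable_induct)
      case base
      then show ?case using verts by auto
    next
      case (step x y)
      then obtain e where e: "e \<in> arcs E" "tail E e = x" "head E e = y"
        by auto
      then have "y \<in> H"
        using H step.prems by (auto simp: hereditary_def)
      moreover have "(x, y) \<in> arcs_ends (restrict_graph E H)"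
        using e step.prems by (auto simp: restrict_graph_def arcs_ends_conv)
      ultimately show ?case
        using step.IH F.adj_reachable_trans by blast
    qed
  qed
qed

text \<open>Firing traced backwards. Saturation speaks of regular vertices only; the sink, whose
  spill is empty, is covered by the second assumption.\<close>

lemma saturated_fires_closed:
  assumes "saturated E H" "\<And>s. is_sink E s \<Longrightarrow> s \<in> H" "fires E \<alpha> \<beta>" "set_mset \<beta> \<subseteq> H"
  shows "set_mset \<alpha> \<subseteq> H"
proof -
  obtain v \<sigma> where v: "v \<in> verts E" "\<alpha> = \<sigma> + chips E v" "\<beta> = \<sigma> + spill E v"
    using assms(3) by (auto simp: fires_def)
  then have "head E ` out_arcs E v \<subseteq> H"
    using assms(4) by (auto simp: set_mset_spill)
  then have "v \<in> H"
    using assms(1,2) v(1) finite_out_arcs[of v] by (auto simp: saturated_def is_regular_def)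
  then show ?thesis
    using v assms(4) by (auto simp: set_mset_chips)
qed

text \<open>Heredity leads from \<beta> down to a common descendant, saturation from there back up
  to \<alpha>. When \<alpha> is a sum, this places both summands on \<open>H\<close>.\<close>

lemma sp_cong_closed:
  assumes H: "hereditary E H" "saturated E H" "H \<noteq> {}"
    and cong: "(\<alpha>, \<beta>) \<in> sp_cong E" and \<beta>: "set_mset \<beta> \<subseteq> H"
  shows "set_mset \<alpha> \<subseteq> H"
proof -
  obtain \<gamma> where \<gamma>: "(fires E)\<^sup>*\<^sup>* \<alpha> \<gamma>" "(fires E)\<^sup>*\<^sup>* \<beta> \<gamma>"
    using cong by (auto simp: sp_cong_iff_joinable)
  have "set_mset \<gamma> \<subseteq> H"
    using hereditary_rtranclp_fires_closed[OF \<gamma>(2) H(1) \<beta>] .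
  with \<gamma>(1) show ?thesis
    using saturated_fires_closed[OF H(2) sink_mem_hereditary[OF H(1,3)]]
    by (induction rule: converse_rtranclp_induct) auto
qed

end

section \<open>Idempotents and hereditary saturated sets\<close>

context sandpile_graph
begin

text \<open>The divisors of an idempotent are closed under sums and under passing to summands, so a
  configuration can be tested chip by chip.\<close>

lemma sp_class_mset_divides:
  assumes x: "x \<in> idempotents (SP E)" and \<beta>: "\<beta> \<in> free_elems E"
  shows "sp_class E \<beta> divides\<^bsub>SP E\<^esub> x \<longleftrightarrow> (\<forall>v\<in>#\<beta>. sp_class E {#v#} divides\<^bsub>SP E\<^esub> x)"
  using \<beta>
proof (induction \<beta>)
  case empty
  interpret comm_monoid "SP E" by (rule comm_monoid_SP)
  have "\<one>\<^bsub>SP E\<^esub> divides\<^bsub>SP E\<^esub> x"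
    using idempotentsD(1)[OF x] by (intro dividesI[of x]) auto
  then show ?case by (simp add: SP_one)
next
  case (add v \<beta>)
  interpret comm_monoid "SP E" by (rule comm_monoid_SP)
  have free: "{#v#} \<in> free_elems E" "\<beta> \<in> free_elems E"
    using add.prems by (auto simp: free_elems_def)
  note carr = free[THEN sp_class_carrier]
  have eq: "sp_class E (add_mset v \<beta>) = sp_class E {#v#} \<otimes>\<^bsub>SP E\<^esub> sp_class E \<beta>"
    using free by (simp add: SP_mult)
  have "a divides\<^bsub>SP E\<^esub> x"
    if "(a \<otimes>\<^bsub>SP E\<^esub> b) divides\<^bsub>SP E\<^esub> x" "a \<in> carrier (SP E)" "b \<in> carrier (SP E)" for a b
    using that divides_trans[of a "a \<otimes>\<^bsub>SP E\<^esub> b" x] by (auto simp: factor_def)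
  then have "sp_class E (add_mset v \<beta>) divides\<^bsub>SP E\<^esub> x \<longleftrightarrow>
      sp_class E {#v#} divides\<^bsub>SP E\<^esub> x \<and> sp_class E \<beta> divides\<^bsub>SP E\<^esub> x"
    unfolding eq using mult_divides_idem[OF x] carr m_comm by metis
  then show ?case
    using add.IH free by simp
qed

lemma hs_closure_divides_idem:
  assumes \<alpha>: "\<alpha> \<in> free_elems E" and x: "sp_class E \<alpha> \<in> idempotents (SP E)"
    and v: "v \<in> hs_closure E (set_mset \<alpha>)"
  shows "sp_class E {#v#} divides\<^bsub>SP E\<^esub> sp_class E \<alpha>"
proof -
  interpret comm_monoid "SP E" by (rule comm_monoid_SP)
  define K where "K = {v \<in> verts E. sp_class E {#v#} divides\<^bsub>SP E\<^esub> sp_class E \<alpha>}"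
  have K_iff: "sp_class E \<beta> divides\<^bsub>SP E\<^esub> sp_class E \<alpha> \<longleftrightarrow> set_mset \<beta> \<subseteq> K"
    if "\<beta> \<in> free_elems E" for \<beta>
    using that sp_class_mset_divides[OF x that] by (auto simp: K_def free_elems_def)
  \<comment> \<open>The two sides of a toppling are the same element of the monoid, with supports
    \<open>{v}\<close> and the out-neighbours of \<open>v\<close>. One direction of the equivalence
    yields heredity, the other saturation.\<close>
  have firing: "v \<in> K \<longleftrightarrow> head E ` out_arcs E v \<subseteq> K" if v: "v \<in> verts E" for v
  proof -
    have "(chips E v, spill E v) \<in> sp_cong E"
      using v by (rule chips_spill_cong)
    then have "chips E v \<in> free_elems E" "spill E v \<in> free_elems E"
      "sp_class E (chips E v) = sp_class E (spill E v)"
      using sp_cong_free sp_class_eq_iff by blast+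
    then show ?thesis
      using K_iff[of "chips E v"] K_iff[of "spill E v"]
      by (simp add: set_mset_chips set_mset_spill)
  qed
  have K_verts: "K \<subseteq> verts E"
    by (auto simp: K_def)
  have "hereditary E K"
    unfolding hereditary_def
  proof (intro conjI ballI impI)
    fix e assume "e \<in> arcs E" "tail E e \<in> K"
    then show "head E e \<in> K"
      using firing[of "tail E e"] by auto
  qed (auto simp: K_def)
  moreover have "saturated E K"
    unfolding saturated_def is_regular_def using firing K_verts by blast
  moreover have "set_mset \<alpha> \<subseteq> K"
    using K_iff[OF \<alpha>] sp_class_carrier[OF \<alpha>] by simp
  ultimately have "hs_closure E (set_mset \<alpha>) \<subseteq> K"
    by (rule hs_closure_least)
  then show ?thesis
    using v by (auto simp: K_def)
qed

text \<open>Nonemptiness is required of the representative and not of the element: it makes the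
  closure nonempty, hence the restricted graph a sandpile graph.\<close>

lemma eq_sandpile_group_hs_closure:
  assumes \<alpha>: "\<alpha> \<in> free_elems E" "\<alpha> \<noteq> {#}" and x: "sp_class E \<alpha> \<in> idempotents (SP E)"
  shows "eq_sandpile_group E (hs_closure E (set_mset \<alpha>)) (archi_group (SP E) (sp_class E \<alpha>))"
proof -
  define H where "H = hs_closure E (set_mset \<alpha>)"
  define F where "F = restrict_graph E H"
  have \<alpha>_verts: "set_mset \<alpha> \<subseteq> verts E"
    using \<alpha> by (simp add: free_elems_def)
  have H: "hereditary E H" "saturated E H" and \<alpha>H: "set_mset \<alpha> \<subseteq> H"
    unfolding H_def
    using hereditary_hs_closure saturated_hs_closure hs_closure_superset \<alpha>_verts by blast+
  have H_ne: "H \<noteq> {}"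
    using \<alpha>H \<alpha>(2) by auto
  have free_F: "\<beta> \<in> free_elems F \<longleftrightarrow> set_mset \<beta> \<subseteq> H" for \<beta>
    by (simp add: F_def free_elems_restrict)
  have free_E: "\<beta> \<in> free_elems E" if "\<beta> \<in> free_elems F" for \<beta>
    using that H(1) unfolding free_F by (auto simp: free_elems_def hereditary_def)
  have cong_F: "(\<beta>, \<gamma>) \<in> sp_cong F \<longleftrightarrow> (\<beta>, \<gamma>) \<in> sp_cong E"
    if "\<beta> \<in> free_elems F" "\<gamma> \<in> free_elems F" for \<beta> \<gamma>
    using that sp_cong_restrict_iff[OF H(1)] by (simp add: F_def free_elems_restrict)
  have \<alpha>F: "\<alpha> \<in> free_elems F"
    using \<alpha>H free_F by blast
  interpret F: sandpile_graph F
    unfolding F_def using H(1) H_ne by (rule sandpile_graph_restrict)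
  interpret M: comm_monoid "SP E" by (rule comm_monoid_SP)
  interpret N: comm_monoid "SP F" by (rule F.comm_monoid_SP)
  have below: "sp_class E \<beta> divides\<^bsub>SP E\<^esub> sp_class E \<alpha>" if "\<beta> \<in> free_elems F" for \<beta>
    using that hs_closure_divides_idem[OF \<alpha>(1) x] sp_class_mset_divides[OF x free_E[OF that]]
    by (auto simp: free_F H_def)
  \<comment> \<open>A divisor of the idempotent and its complement have a sum congruent to \<alpha>,
    so both are supported on \<open>H\<close>. This turns divisibility in the large monoid into
    divisibility in the small one.\<close>
  have cofactor: "\<beta> \<in> free_elems F \<and> (\<exists>\<gamma>\<in>free_elems F. (\<beta> + \<gamma>, \<alpha>) \<in> sp_cong E)"
    if \<beta>: "\<beta> \<in> free_elems E" "sp_class E \<beta> divides\<^bsub>SP E\<^esub> sp_class E \<alpha>" for \<beta>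
  proof -
    obtain \<gamma> where \<gamma>: "(\<beta> + \<gamma>, \<alpha>) \<in> sp_cong E"
      using \<beta> \<alpha>(1) by (auto simp: sp_class_divides_iff)
    then have "\<beta> + \<gamma> \<in> free_elems F"
      unfolding free_F using sp_cong_closed[OF H H_ne \<gamma> \<alpha>H] by blast
    then show ?thesis using \<gamma> by auto
  qed
  have x': "sp_class F \<alpha> \<in> idempotents (SP F)"
  proof -
    have "(\<alpha> + \<alpha>, \<alpha>) \<in> sp_cong E"
      using M.idempotentsD(2)[OF x] \<alpha>(1) by (simp add: SP_mult sp_class_eq_iff)
    then show ?thesis
      using \<alpha>F by (simp add: idempotents_def F.SP_mult F.sp_class_eq_iff F.sp_class_carrier cong_F)
  qed
  have max: "y divides\<^bsub>SP F\<^esub> sp_class F \<alpha>" if y: "y \<in> carrier (SP F)" for y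
  proof -
    obtain \<beta> where \<beta>: "\<beta> \<in> free_elems F" "y = sp_class F \<beta>"
      using F.SP_cases[OF y] .
    then obtain \<gamma> where \<gamma>: "\<gamma> \<in> free_elems F" "(\<beta> + \<gamma>, \<alpha>) \<in> sp_cong E"
      using cofactor[OF free_E[OF \<beta>(1)] below[OF \<beta>(1)]] by blast
    then have "(\<beta> + \<gamma>, \<alpha>) \<in> sp_cong F"
      using \<beta>(1) \<alpha>F by (simp add: cong_F)
    then show ?thesis
      unfolding \<beta>(2) F.sp_class_divides_iff[OF \<beta>(1) \<alpha>F] using \<gamma>(1) by blast
  qed
  have incl: "sp_incl E (sp_class F \<beta>) = sp_class E \<beta>" if \<beta>: "\<beta> \<in> free_elems F" for \<beta>
  proof -
    have "sp_class E \<gamma> = sp_class E \<beta>" if "\<gamma> \<in> sp_class F \<beta>" for \<gamma>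
    proof -
      have *: "(\<beta>, \<gamma>) \<in> sp_cong F"
        using that by (simp add: F.mem_sp_class_iff)
      then have "\<gamma> \<in> free_elems F"
        using F.sp_cong_free by blast
      then have "(\<beta>, \<gamma>) \<in> sp_cong E"
        using * \<beta> cong_F by blast
      then show ?thesis
        using sp_cong_free sp_class_eq_iff by blast
    qed
    moreover have "\<beta> \<in> sp_class F \<beta>"
      using \<beta> by (simp add: F.mem_sp_class_iff sp_cong.refl)
    ultimately show ?thesis
      unfolding sp_incl_def sp_class_def[of E, symmetric] by blast
  qed
  have incl_mult: "sp_incl E (a \<otimes>\<^bsub>SP F\<^esub> b) = sp_incl E a \<otimes>\<^bsub>SP E\<^esub> sp_incl E b"
    if ab: "a \<in> carrier (SP F)" "b \<in> carrier (SP F)" for a b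
  proof -
    obtain \<beta> where "\<beta> \<in> free_elems F" "a = sp_class F \<beta>"
      by (rule F.SP_cases[OF ab(1)])
    moreover obtain \<gamma> where "\<gamma> \<in> free_elems F" "b = sp_class F \<gamma>"
      by (rule F.SP_cases[OF ab(2)])
    ultimately show ?thesis
      using free_E by (simp add: F.SP_mult SP_mult incl)
  qed
  have incl_inj: "inj_on (sp_incl E) (carrier (SP F))"
  proof (rule inj_onI)
    fix a b assume ab: "a \<in> carrier (SP F)" "b \<in> carrier (SP F)" "sp_incl E a = sp_incl E b"
    obtain \<beta> where \<beta>: "\<beta> \<in> free_elems F" "a = sp_class F \<beta>"
      by (rule F.SP_cases[OF ab(1)])
    obtain \<gamma> where \<gamma>: "\<gamma> \<in> free_elems F" "b = sp_class F \<gamma>"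
      by (rule F.SP_cases[OF ab(2)])
    have "sp_class E \<beta> = sp_class E \<gamma>"
      using ab(3) \<beta> \<gamma> by (simp add: incl)
    then show "a = b"
      using \<beta> \<gamma> free_E by (simp add: sp_class_eq_iff F.sp_class_eq_iff cong_F)
  qed
  define I where "I = sp_class F \<alpha> <#\<^bsub>SP F\<^esub> carrier (SP F)"
  have I_sub: "I \<subseteq> carrier (SP F)"
    using N.idempotentsD(1)[OF x'] by (auto simp: I_def l_coset_def)
  have I_ideal: "smallest_ideal (SP F) = I"
    unfolding I_def using x' max by (rule N.smallest_ideal_eq)
  \<comment> \<open>The image of the ideal consists of elements that divide the idempotent and
    absorb it. Conversely, everything in the class divides the idempotent and so has a
    representative on \<open>H\<close>.\<close>
  have image: "sp_incl E ` I = sp_class E \<alpha> <#\<^bsub>SP E\<^esub> archi_class (SP E) (sp_class E \<alpha>)"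
  proof (intro equalityI subsetI)
    fix y assume "y \<in> sp_incl E ` I"
    then obtain b where b: "b \<in> carrier (SP F)" "y = sp_incl E (sp_class F \<alpha> \<otimes>\<^bsub>SP F\<^esub> b)"
      by (auto simp: I_def l_coset_def)
    obtain \<beta> where \<beta>: "\<beta> \<in> free_elems F" "b = sp_class F \<beta>"
      using F.SP_cases[OF b(1)] .
    have carr: "sp_class E \<alpha> \<in> carrier (SP E)" "sp_class E \<beta> \<in> carrier (SP E)"
      using \<alpha> \<beta> free_E sp_class_carrier by auto
    have y: "y = sp_class E \<alpha> \<otimes>\<^bsub>SP E\<^esub> sp_class E \<beta>"
      using b(2) \<beta> \<alpha>F by (simp add: F.SP_mult SP_mult incl \<alpha>(1) free_E)
    have absorb: "sp_class E \<alpha> \<otimes>\<^bsub>SP E\<^esub> y = y"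
      using carr M.idempotentsD(2)[OF x] unfolding y by (simp add: M.m_assoc[symmetric])
    have "y divides\<^bsub>SP E\<^esub> sp_class E \<alpha>"
      unfolding y using carr below[OF \<beta>(1)] by (intro M.mult_divides_idem[OF x]) auto
    then have "y \<in> archi_class (SP E) (sp_class E \<alpha>)"
      using absorb carr y by (intro M.absorbing_mem_archi_class[OF x]) auto
    then show "y \<in> sp_class E \<alpha> <#\<^bsub>SP E\<^esub> archi_class (SP E) (sp_class E \<alpha>)"
      using absorb unfolding l_coset_def by force
  next
    fix y assume "y \<in> sp_class E \<alpha> <#\<^bsub>SP E\<^esub> archi_class (SP E) (sp_class E \<alpha>)"
    then obtain z where z: "z \<in> archi_class (SP E) (sp_class E \<alpha>)" "y = sp_class E \<alpha> \<otimes>\<^bsub>SP E\<^esub> z"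
      by (auto simp: l_coset_def)
    then have zc: "z \<in> carrier (SP E)" "z divides\<^bsub>SP E\<^esub> sp_class E \<alpha>"
      by (auto simp: M.archi_class_idem_iff[OF x])
    obtain \<beta> where \<beta>: "\<beta> \<in> free_elems E" "z = sp_class E \<beta>"
      using SP_cases[OF zc(1)] .
    then have \<beta>F: "\<beta> \<in> free_elems F"
      using cofactor zc by blast
    have "y = sp_incl E (sp_class F \<alpha> \<otimes>\<^bsub>SP F\<^esub> sp_class F \<beta>)"
      using z(2) \<beta> \<beta>F \<alpha> \<alpha>F by (simp add: F.SP_mult SP_mult incl)
    then show "y \<in> sp_incl E ` I"
      using F.sp_class_carrier[OF \<beta>F] by (auto simp: I_def l_coset_def)
  qed
  have "sp_incl E \<in> iso (recurrent_group (SP F)) (archi_group (SP E) (sp_class E \<alpha>))"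
    unfolding iso_def hom_def bij_betw_def recurrent_group_def archi_group_def
    using image incl_mult[OF subsetD[OF I_sub] subsetD[OF I_sub]] inj_on_subset[OF incl_inj I_sub]
    by (auto simp: I_ideal)
  moreover have "groth_of (SP F) \<in> iso (recurrent_group (SP F)) (sandpile_group F)"
    unfolding sandpile_group_def using x' max by (rule N.groth_of_iso)
  ultimately show ?thesis
    by (simp add: eq_sandpile_group_def F_def H_def)
qed

section \<open>Cycles and the closure of the sink\<close>

lemma dominates_iff_out_arcs: "v \<rightarrow>\<^bsub>E\<^esub> w \<longleftrightarrow> w \<in> head E ` out_arcs E v"
  by (auto simp: arcs_ends_conv out_arcs_def)

text \<open>A path that starts at the sink is trivial, and no arc of a cycle starts there.\<close>

lemma sink_mem_acyclic_part:
  assumes "is_sink E s"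
  shows "s \<in> acyclic_part E"
proof -
  have "\<not> (cycle p \<and> e \<in> set p \<and> s \<rightarrow>\<^sup>*\<^bsub>E\<^esub> tail E e)" for p e
  proof
    assume *: "cycle p \<and> e \<in> set p \<and> s \<rightarrow>\<^sup>*\<^bsub>E\<^esub> tail E e"
    then have e: "e \<in> arcs E"
      by (auto simp: cycle_def awalk_def)
    have no_arc: "\<not> (s \<rightarrow>\<^bsub>E\<^esub> w)" for w
      using assms by (simp add: is_sink_def dominates_iff_out_arcs)
    have "tail E e = s"
      using * no_arc by (auto elim: converse_reachable_cases)
    then show False
      using e assms by (auto simp: is_sink_def)
  qed
  then show ?thesis
    using assms by (auto simp: acyclic_part_def connects_to_cycle_def is_sink_def)
qed

lemma connects_to_cycle_step:
  assumes "v \<rightarrow>\<^bsub>E\<^esub> w" "connects_to_cycle E w"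
  shows "connects_to_cycle E v"
  using assms adj_reachable_trans unfolding connects_to_cycle_def by blast

text \<open>The delicate case is a vertex on the cycle itself: there the step follows the cycle, and
  going round leads back. Contraposition gives saturation of the acyclic part.\<close>

lemma connects_to_cycle_succ:
  assumes "connects_to_cycle E v"
  obtains w where "v \<rightarrow>\<^bsub>E\<^esub> w" "connects_to_cycle E w"
proof -
  obtain p e where p: "cycle p" "e \<in> set p" "v \<rightarrow>\<^sup>*\<^bsub>E\<^esub> tail E e"
    using assms by (auto simp: connects_to_cycle_def)
  from p(3) show ?thesis
  proof (cases rule: converse_reachable_cases)
    case base
    obtain u where u: "awalk u p u"
      using p(1) by (auto simp: cycle_def)
    obtain q r where "p = q @ e # r"
      using p(2) by (auto dest: split_list)
    then have "awalk u q (tail E e)" "awalk (head E e) r u" "e \<in> arcs E"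
      using u by (auto simp: awalk_Cons_iff)
    then have "head E e \<rightarrow>\<^sup>*\<^bsub>E\<^esub> tail E e"
      using reachable_awalkI reachable_trans by blast
    then have "connects_to_cycle E (head E e)"
      using p by (auto simp: connects_to_cycle_def)
    moreover have "v \<rightarrow>\<^bsub>E\<^esub> head E e"
      using base \<open>e \<in> arcs E\<close> by (auto simp: arcs_ends_conv)
    ultimately show ?thesis using that by blast
  next
    case (step w)
    then show ?thesis
      using that p by (auto simp: connects_to_cycle_def)
  qed
qed

lemma hereditary_acyclic_part: "hereditary E (acyclic_part E)"
proof -
  have "tail E e \<rightarrow>\<^bsub>E\<^esub> head E e" if "e \<in> arcs E" for e
    using that by (auto simp: arcs_ends_conv)
  then show ?thesis
    using connects_to_cycle_step by (auto simp: hereditary_def acyclic_part_def)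
qed

lemma saturated_acyclic_part: "saturated E (acyclic_part E)"
  unfolding saturated_def
proof (intro conjI allI impI)
  show "acyclic_part E \<subseteq> verts E" by (auto simp: acyclic_part_def)
  fix v assume v: "is_regular E v \<and> head E ` out_arcs E v \<subseteq> acyclic_part E"
  have "\<not> connects_to_cycle E v"
  proof
    assume "connects_to_cycle E v"
    then obtain w where w: "v \<rightarrow>\<^bsub>E\<^esub> w" "connects_to_cycle E w"
      by (rule connects_to_cycle_succ)
    then have "w \<in> acyclic_part E"
      using v by (auto simp: dominates_iff_out_arcs)
    then show False
      using w by (simp add: acyclic_part_def)
  qed
  then show "v \<in> acyclic_part E"
    using v by (simp add: acyclic_part_def is_regular_def)
qed

text \<open>Shortening the way back from \<open>w\<close> to a simple path makes the ranges along
  the closed walk distinct, as \<open>cycle\<close> demands.\<close>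

lemma reachable1_self_connects_to_cycle:
  assumes "v \<rightarrow>\<^sup>+\<^bsub>E\<^esub> v"
  shows "connects_to_cycle E v"
proof -
  obtain w where w: "v \<rightarrow>\<^bsub>E\<^esub> w" "(w, v) \<in> (arcs_ends E)\<^sup>*"
    using tranclD[OF assms] by blast
  then have "w \<rightarrow>\<^sup>*\<^bsub>E\<^esub> v"
    using reachable_conv' adj_in_verts by (metis reachable1_reachable reachable_refl rtranclD)
  then obtain q where q: "apath w q v"
    using reachable_apath by blast
  obtain e where e: "e \<in> arcs E" "tail E e = v" "head E e = w"
    using w(1) by auto
  have "awalk v (e # q) v" "distinct (tl (awalk_verts v (e # q)))"
    using q e by (auto simp: apath_def awalk_Cons_iff)
  then have "cycle (e # q)"
    by (auto simp: cycle_def)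
  moreover have "v \<rightarrow>\<^sup>*\<^bsub>E\<^esub> tail E e"
    using e by auto
  ultimately show ?thesis
    unfolding connects_to_cycle_def by force
qed

lemma hs_closure_sink:
  assumes s: "is_sink E s"
  shows "hs_closure E {s} = acyclic_part E"
proof
  show "hs_closure E {s} \<subseteq> acyclic_part E"
    using hereditary_acyclic_part saturated_acyclic_part sink_mem_acyclic_part[OF s]
    by (intro hs_closure_least) auto
  have sv: "{s} \<subseteq> verts E"
    using s by (simp add: is_sink_def)
  \<comment> \<open>Pairs are (successor, predecessor), so well-founded induction supplies the claim
    for the ranges of the arcs leaving \<open>v\<close>.\<close>
  define R where "R = {(w, v). v \<in> acyclic_part E \<and> v \<rightarrow>\<^bsub>E\<^esub> w}"
  have "finite R"
  proof (rule finite_subset)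
    show "R \<subseteq> (arcs_ends E)\<inverse>" by (auto simp: R_def)
    show "finite ((arcs_ends E)\<inverse>)" by (simp add: arcs_ends_conv)
  qed
  moreover have "acyclic R"
  proof (rule acyclicI, rule allI, rule notI)
    fix v assume vv: "(v, v) \<in> R\<^sup>+"
    have "b \<in> acyclic_part E \<and> b \<rightarrow>\<^sup>+\<^bsub>E\<^esub> a" if "(a, b) \<in> R\<^sup>+" for a b
      using that by (induction rule: trancl_induct) (auto simp: R_def intro: trancl_into_trancl2)
    with vv show False
      using reachable1_self_connects_to_cycle by (auto simp: acyclic_part_def)
  qed
  ultimately have "wf R"
    by (rule finite_acyclic_wf)
  then have "v \<in> acyclic_part E \<longrightarrow> v \<in> hs_closure E {s}" for v
  proof (induction v)
    case (less v)
    show ?case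
    proof
      assume v: "v \<in> acyclic_part E"
      show "v \<in> hs_closure E {s}"
      proof (cases "is_sink E v")
        case True
        then have "v = s" using s unique_sink by auto
        then show ?thesis using hs_closure_superset[OF sv] by auto
      next
        case False
        then have reg: "is_regular E v"
          using v finite_out_arcs[of v] by (simp add: is_regular_def acyclic_part_def)
        have "head E e \<in> hs_closure E {s}" if e: "e \<in> out_arcs E v" for e
        proof -
          have "(head E e, v) \<in> R"
            using v e by (auto simp: R_def arcs_ends_conv)
          moreover have "head E e \<in> acyclic_part E"
            using hereditary_acyclic_part v e by (auto simp: hereditary_def)
          ultimately show ?thesis using less.IH by blast
        qed
        then show ?thesis
          using saturated_hs_closure[OF sv] reg by (auto simp: saturated_def)
      qed
    qed
  qed
  then show "acyclic_part E \<subseteq> hs_closure E {s}" by blast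
qed

text \<open>The empty multiset represents 0 as well, but its closure is empty and carries no
  sandpile graph; a single chip at the sink is a nonempty representative.\<close>

lemma eq_sandpile_group_acyclic_part:
  "eq_sandpile_group E (acyclic_part E) (archi_group (SP E) \<one>\<^bsub>SP E\<^esub>)"
proof -
  interpret comm_monoid "SP E" by (rule comm_monoid_SP)
  obtain s where s: "is_sink E s"
    using unique_sink by blast
  then have free: "{#s#} \<in> free_elems E"
    by (simp add: free_elems_def is_sink_def)
  have one: "sp_class E {#s#} = \<one>\<^bsub>SP E\<^esub>"
    unfolding SP_one using free sp_cong.sink[OF s] by (simp add: sp_class_eq_iff)
  have "\<one>\<^bsub>SP E\<^esub> \<in> idempotents (SP E)"
    by (simp add: idempotents_def)
  then show ?thesis
    using eq_sandpile_group_hs_closure[OF free] one hs_closure_sink[OF s] by simp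
qed

lemma eq_sandpile_group_supp:
  assumes x: "x \<in> idempotents (SP E)" "x \<noteq> \<one>\<^bsub>SP E\<^esub>" and \<alpha>: "\<alpha> \<in> x"
  shows "eq_sandpile_group E (hs_closure E (set_mset \<alpha>)) (archi_group (SP E) x)"
proof -
  have "x \<in> carrier (SP E)"
    using x(1) by (simp add: idempotents_def)
  from sp_class_of_mem[OF this \<alpha>]
  have *: "\<alpha> \<in> free_elems E" "x = sp_class E \<alpha>" .
  then have "\<alpha> \<noteq> {#}"
    using x(2) by (auto simp: SP_one)
  then show ?thesis
    using eq_sandpile_group_hs_closure * x(1) by simp
qed

end

theorem theorem3p9:
  fixes E :: "('v, 'e) pre_digraph"
  assumes "sandpile_graph E"
  shows
    "(\<forall>x\<in>carrier (SP E). subsemigroup (archi_class (SP E) x) (SP E) \<and>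
        (\<exists>!e. e \<in> archi_class (SP E) x \<and> e \<in> idempotents (SP E)))
     \<and>
     carrier (SP E) = (\<Union>x\<in>idempotents (SP E). archi_class (SP E) x) \<and>
     disjoint_family_on (archi_class (SP E)) (idempotents (SP E))
     \<and>
     is_dirlim (idempotents (SP E)) (\<lambda>e f. e divides\<^bsub>SP E\<^esub> f)
       (\<lambda>e. grothendieck (archi_semigroup (SP E) e))
       (\<lambda>e f. groth_map (archi_semigroup (SP E) f) (\<lambda>y. f \<otimes>\<^bsub>SP E\<^esub> y))
       (sandpile_group E)
       (\<lambda>e. groth_map (SP E) (\<lambda>y. y))
     \<and>
     (\<forall>x\<in>idempotents (SP E).
        grothendieck (archi_semigroup (SP E) x) \<cong> archi_group (SP E) x \<and>
        (x = \<one>\<^bsub>SP E\<^esub> \<longrightarrow> eq_sandpile_group E (acyclic_part E) (archi_group (SP E) x)) \<and>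
        (x \<noteq> \<one>\<^bsub>SP E\<^esub> \<longrightarrow>
           (\<forall>\<alpha>\<in>x. eq_sandpile_group E (hs_closure E (set_mset \<alpha>)) (archi_group (SP E) x)))) \<and>
     sandpile_group E \<cong> archi_group (SP E) (e_max (SP E))
     \<and>
     (\<forall>G\<in>maximal_subgroups (SP E). \<exists>x\<in>idempotents (SP E). G \<cong> archi_group (SP E) x) \<and>
     maximal_subgroups (SP E) = {archi_group (SP E) x | x. x \<in> idempotents (SP E)}"
proof -
  interpret sandpile_graph E by fact
  interpret SP: finite_comm_monoid "SP E" by (rule finite_comm_monoid_SP)
  have "G \<cong> archi_group (SP E) x" if "G = archi_group (SP E) x" for G x
    using that iso_set_refl by (auto simp: is_iso_def)
  then have "\<forall>G\<in>maximal_subgroups (SP E). \<exists>x\<in>idempotents (SP E). G \<cong> archi_group (SP E) x"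
    unfolding SP.maximal_subgroups_eq by blast
  then show ?thesis
    unfolding sandpile_group_def
    using SP.subsemigroup_archi_class SP.archi_class_unique_idem SP.archi_class_partition
      SP.grothendieck_dirlim SP.grothendieck_iso_archi_group eq_sandpile_group_acyclic_part
      eq_sandpile_group_supp SP.grothendieck_iso_archi_group_e_max SP.maximal_subgroups_eq
    by (intro conjI ballI impI) simp_all
qed

end
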